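(* Let $f:M\to M$ be a Lipschitz continuous transitive hyperbolic homeomorphism of a compact metric space $(M,d)$, let $A,B:M\to GL(d,\mathbb{R})$ be two $\nu$-H\"older continuous maps and let $\alpha\in\mathrm{Aut}(GL(d,\mathbb{R}))$. Suppose that the $\alpha$-twisted cocycles $A_\alpha$ and $B_\alpha$ generated by $A$ and $B$ over $f$ are both fiber-bunched. Suppose moreover that $$A^n_\alpha(p)=B^n_\alpha(p)\quad\text{for all } n\in\mathbb{Z} \text{ and all } p\in\mathrm{Fix}(f^n).$$ Then there exists a $\nu$-H\"older continuous map $P:M\to GL(d,\mathbb{R})$ such that $$A^n_\alpha(x)=P(f^n(x))\,B^n_\alpha(x)\,\alpha^n(P(x))^{-1}\quad\text{for all } x\in M \text{ and all } n\in\mathbb{Z}.$$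
   Context: Hyperbolic homeomorphism. For a homeomorphism $f:M\to M$ of a compact metric space $(M,d)$, $x\in M$ and $\varepsilon>0$, let $W^s_\varepsilon(x)=\{y\in M: d(f^n(x),f^n(y))\le\varepsilon\ \forall n\ge0\}$ and $W^u_\varepsilon(x)=\{y\in M: d(f^n(x),f^n(y))\le\varepsilon\ \forall n\le0\}$. The map $f$ is called hyperbolic (with local product structure) if there are constants $C,\varepsilon,\lambda,\tau>0$ (fixed from now on) such that: (1) $d(f^n(y_1),f^n(y_2))\le Ce^{-\lambda n}d(y_1,y_2)$ for all $x\in M$, $y_1,y_2\in W^s_\varepsilon(x)$, $n\ge0$; (2) $d(f^{-n}(y_1),f^{-n}(y_2))\le Ce^{-\lambda n}d(y_1,y_2)$ for all $x\in M$, $y_1,y_2\in W^u_\varepsilon(x)$, $n\ge0$; (3) if $d(x,y)\le\tau$ then $W^s_\varepsilon(x)\cap W^u_\varepsilon(y)$ consists of exactly one point $[x,y]$, which depends continuously on $x$ and $y$. Twisted cocycles. $\mathrm{Aut}(GL(d,\mathbb{R}))$ is the group of automorphisms of the group $GL(d,\mathbb{R})$, and $\alpha^n$ is the $n$-th iterate of $\alpha$ ($n\in\mathbb{Z}$). A map $A:M\to GL(d,\mathbb{R})$ generates the $\alpha$-twisted cocycle $A_\alpha$ over $f$ defined by $A^n_\alpha(x)=A(f^{n-1}(x))\,\alpha(A(f^{n-2}(x)))\cdots\alpha^{n-1}(A(x))$ if $n>0$, $A^0_\alpha(x)=\mathrm{Id}$, and $A^n_\alpha(x)=\alpha^n\big(A^{-n}_\alpha(f^n(x))^{-1}\big)$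 if $n<0$. It satisfies $A^{m+n}_\alpha(x)=A^n_\alpha(f^m(x))\,\alpha^n(A^m_\alpha(x))$ for all $m,n\in\mathbb{Z}$. The cocycle $B_\alpha$ is defined likewise from $B$. H\"older maps. $\|\cdot\|$ is the operator norm of matrices; a map $A:M\to GL(d,\mathbb{R})$ is $\nu$-H\"older if there is $C>0$ with $\|A(x)-A(y)\|\le C\,d(x,y)^\nu$ for all $x,y\in M$. Fiber-bunching. The cocycle $A_\alpha$ generated by the $\nu$-H\"older map $A$ is fiber-bunched if there are constants $C>0$ and $\rho,\theta>0$ with $5\rho+2\theta<\nu\lambda$ (with $\lambda$ the hyperbolicity constant of $f$ above) such that for every $n\in\mathbb{Z}$: (i) $\|\alpha^{-n}(A^n_\alpha(x))\|\,\|\alpha^{-n}(A^n_\alpha(x)^{-1})\|<Ce^{\theta|n|}$ for every $x\in M$; (ii) $\|\alpha^n(T_1)-\alpha^n(T_2)\|\le Ce^{\rho|n|}\|T_1-T_2\|$ for all $T_1,T_2\in GL(d,\mathbb{R})$; (iii) $\|\alpha^n(T)\|\le Ce^{\rho|n|}\|T\|$ for all $T\in GL(d,\mathbb{R})$. $\mathrm{Fix}(f^n)$ denotes the set of fixed points of $f^n$. *)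

theory Defs
  imports "HOL-Analysis.Analysis" "HOL-Algebra.Bij"
begin

section \<open>Hyperbolic homeomorphisms\<close>

text \<open>A compact metric space \<open>M\<close> is a type of class \<open>metric_space\<close> with compact \<^term>\<open>UNIV\<close>.\<close>

definition int_iterate :: "('a \<Rightarrow> 'a) \<Rightarrow> int \<Rightarrow> 'a \<Rightarrow> 'a" where
  "int_iterate f n = (if 0 \<le> n then f ^^ nat n else inv_into UNIV f ^^ nat (- n))"

definition stable_set :: "('a::metric_space \<Rightarrow> 'a) \<Rightarrow> real \<Rightarrow> 'a \<Rightarrow> 'a set" where
  "stable_set f \<epsilon> x = {y. \<forall>n\<ge>0. dist (int_iterate f n x) (int_iterate f n y) \<le> \<epsilon>}"

definition unstable_set :: "('a::metric_space \<Rightarrow> 'a) \<Rightarrow> real \<Rightarrow> 'a \<Rightarrow> 'a set" where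
  "unstable_set f \<epsilon> x = {y. \<forall>n\<le>0. dist (int_iterate f n x) (int_iterate f n y) \<le> \<epsilon>}"

definition hyperbolic ::
    "('a::metric_space \<Rightarrow> 'a) \<Rightarrow> real \<Rightarrow> real \<Rightarrow> real \<Rightarrow> real \<Rightarrow> bool" where
  "hyperbolic f C \<epsilon> l \<tau> \<longleftrightarrow>
     C > 0 \<and> \<epsilon> > 0 \<and> l > 0 \<and> \<tau> > 0 \<and>
     (\<forall>x. \<forall>y1\<in>stable_set f \<epsilon> x. \<forall>y2\<in>stable_set f \<epsilon> x. \<forall>n\<ge>0.
        dist (int_iterate f n y1) (int_iterate f n y2) \<le> C * exp (- l * of_int n) * dist y1 y2) \<and>
     (\<forall>x. \<forall>y1\<in>unstable_set f \<epsilon> x. \<forall>y2\<in>unstable_set f \<epsilon> x. \<forall>n\<ge>0.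
        dist (int_iterate f (- n) y1) (int_iterate f (- n) y2) \<le> C * exp (- l * of_int n) * dist y1 y2) \<and>
     (\<exists>br. (\<forall>x y. dist x y \<le> \<tau> \<longrightarrow> stable_set f \<epsilon> x \<inter> unstable_set f \<epsilon> y = {br (x, y)}) \<and>
        continuous_on {(x, y). dist x y \<le> \<tau>} br)"

text \<open>Transitivity means a dense \<^emph>\<open>forward\<close> orbit. A dense two-sided orbit would be strictly
  weaker: the subshift consisting of two fixed points and one heteroclinic orbit has one.\<close>

definition transitive_map :: "('a::topological_space \<Rightarrow> 'a) \<Rightarrow> bool" where
  "transitive_map f \<longleftrightarrow> (\<exists>x. closure (range (\<lambda>n::nat. (f ^^ n) x)) = UNIV)"


section \<open>The general linear group and twisted cocycles\<close>

definition GL :: "(real ^ 'd ^ 'd) monoid" where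
  "GL = \<lparr>carrier = {T. invertible T}, mult = (**), one = mat 1\<rparr>"

lemma group_GL: "group (GL :: (real ^ 'd ^ 'd) monoid)"
proof (rule groupI)
  fix T :: "real ^ 'd ^ 'd"
  assume "T \<in> carrier GL"
  then obtain S where "T ** S = mat 1" "S ** T = mat 1"
    by (auto simp: GL_def invertible_def)
  then show "\<exists>S\<in>carrier GL. S \<otimes>\<^bsub>GL\<^esub> T = \<one>\<^bsub>GL\<^esub>"
    by (auto simp: GL_def invertible_def)
qed (auto simp: GL_def invertible_mult matrix_mul_assoc, auto simp: invertible_def intro: exI[of _ "mat 1"])

text \<open>Powers with integer exponent in the automorphism group; elements of this group are
  undefined outside \<^term>\<open>carrier GL\<close>.\<close>

abbreviation aut_pow :: "(real ^ 'd ^ 'd \<Rightarrow> real ^ 'd ^ 'd) \<Rightarrow> int \<Rightarrow> real ^ 'd ^ 'd \<Rightarrow> real ^ 'd ^ 'd" where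
  "aut_pow \<alpha> n \<equiv> \<alpha> [^]\<^bsub>AutoGroup GL\<^esub> n"

text \<open>For \<open>n \<ge> 0\<close>: the ordered product
  \<open>A (f\<^sup>n\<^sup>-\<^sup>1 x) ** \<alpha> (A (f\<^sup>n\<^sup>-\<^sup>2 x)) ** \<dots> ** \<alpha>\<^sup>n\<^sup>-\<^sup>1 (A x)\<close>.\<close>

definition forward_cocycle ::
    "('a \<Rightarrow> 'a) \<Rightarrow> (real ^ 'd ^ 'd \<Rightarrow> real ^ 'd ^ 'd) \<Rightarrow> ('a \<Rightarrow> real ^ 'd ^ 'd) \<Rightarrow> nat \<Rightarrow> 'a \<Rightarrow> real ^ 'd ^ 'd" where
  "forward_cocycle f \<alpha> A n x =
     foldr (\<lambda>i T. aut_pow \<alpha> (int i) (A ((f ^^ (n - 1 - i)) x)) ** T) [0..<n] (mat 1)"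

definition twisted_cocycle ::
    "('a \<Rightarrow> 'a) \<Rightarrow> (real ^ 'd ^ 'd \<Rightarrow> real ^ 'd ^ 'd) \<Rightarrow> ('a \<Rightarrow> real ^ 'd ^ 'd) \<Rightarrow> int \<Rightarrow> 'a \<Rightarrow> real ^ 'd ^ 'd" where
  "twisted_cocycle f \<alpha> A n x =
     (if 0 \<le> n then forward_cocycle f \<alpha> A (nat n) x
      else aut_pow \<alpha> n (matrix_inv (forward_cocycle f \<alpha> A (nat (- n)) (int_iterate f n x))))"

text \<open>The library norm on matrices is the Frobenius norm, hence the use of \<^const>\<open>onorm\<close>.\<close>

abbreviation opnorm :: "real ^ 'd ^ 'd \<Rightarrow> real" where
  "opnorm T \<equiv> onorm (\<lambda>v. T *v v)"

definition holder_GL :: "real \<Rightarrow> ('a::metric_space \<Rightarrow> real ^ 'd ^ 'd) \<Rightarrow> bool" where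
  "holder_GL \<nu> A \<longleftrightarrow> (\<forall>x. A x \<in> carrier GL) \<and>
     (\<exists>C>0. \<forall>x y. opnorm (A x - A y) \<le> C * dist x y powr \<nu>)"

definition fiber_bunched ::
    "('a \<Rightarrow> 'a) \<Rightarrow> real \<Rightarrow> real \<Rightarrow> (real ^ 'd ^ 'd \<Rightarrow> real ^ 'd ^ 'd) \<Rightarrow> ('a \<Rightarrow> real ^ 'd ^ 'd) \<Rightarrow> bool" where
  "fiber_bunched f l \<nu> \<alpha> A \<longleftrightarrow>
     (\<exists>C \<rho> \<theta>. C > 0 \<and> \<rho> > 0 \<and> \<theta> > 0 \<and> 5 * \<rho> + 2 * \<theta> < \<nu> * l \<and>
       (\<forall>n::int.
         (\<forall>x. opnorm (aut_pow \<alpha> (- n) (twisted_cocycle f \<alpha> A n x)) *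
              opnorm (aut_pow \<alpha> (- n) (matrix_inv (twisted_cocycle f \<alpha> A n x)))
              < C * exp (\<theta> * of_int \<bar>n\<bar>)) \<and>
         (\<forall>T1\<in>carrier GL. \<forall>T2\<in>carrier GL.
            opnorm (aut_pow \<alpha> n T1 - aut_pow \<alpha> n T2) \<le> C * exp (\<rho> * of_int \<bar>n\<bar>) * opnorm (T1 - T2)) \<and>
         (\<forall>T\<in>carrier GL. opnorm (aut_pow \<alpha> n T) \<le> C * exp (\<rho> * of_int \<bar>n\<bar>) * opnorm T)))"

end

theory Submission
  imports Defs
begin

text \<open>
  The matrices \<open>Q\<^sub>n(x) = (\<alpha>\<^sup>-\<^sup>n A\<^sup>n(x))\<^sup>-\<^sup>1 (\<alpha>\<^sup>-\<^sup>n B\<^sup>n(x))\<close> play the role of holonomies. If the orbits of \<open>x\<close> and \<open>y\<close>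
  converge exponentially, fiber-bunching gives \<open>Q\<^sub>n(x) = U Q\<^sub>n(y) V\<close> with \<open>U, V\<close> within
  \<open>O(d(x,y)\<^sup>\<nu>)\<close> of the identity, uniformly in \<open>n\<close>; and coincidence of the periodic data means
  \<open>Q\<^sub>m(q) = Q\<^sub>n(q)\<close> whenever \<open>f\<^sup>m(q) = f\<^sup>n(q)\<close>. On a periodic orbit \<open>P(f\<^sup>i r) = Q\<^sub>-\<^sub>i(f\<^sup>i r)\<close> is therefore
  well defined, and it is \<open>\<nu>\<close>-Hoelder with constants independent of the orbit: two nearby points \<open>y, y'\<close> of
  it are compared through the heteroclinic point \<open>[y', y]\<close>, whose long orbit segments are shadowed by
  periodic orbits. Periodic orbits approximate a dense orbit, so the estimate passes to
  \<open>P(f\<^sup>n x\<^sub>0) = A\<^sup>n(x\<^sub>0) B\<^sup>n(x\<^sub>0)\<^sup>-\<^sup>1\<close>, which extends to the whole space. Exchanging \<open>A\<close> and \<open>B\<close>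
  extends the inverse as well.
\<close>

section \<open>Invertible matrices and the operator norm\<close>

text \<open>Closing shadows an orbit segment only with an error uniform along it, so comparing
  ratios over time \<open>n\<close> costs a factor \<open>exp (\<sigma> * n)\<close>, with \<sigma>
  the amplification rate. A recurrence of the dense orbit gives no relation between its gap and its
  length, so this cost cannot be absorbed there. At the heteroclinic point it can: the segment from
  time \<open>-m\<close> to time \<open>n\<close>, both about \<open>s * N\<close>, has a gap of
  order \<open>exp (- l * N * s)\<close>, and measuring from its middle leaves an error of order
  \<open>exp ((\<sigma> - \<nu> * l) * N * s)\<close>, which vanishes because \<sigma> < \<nu> l.
  The dense orbit is then compared with periodic ones only over times fixed in advance, while the
  periodic points move towards it. Closeness is expressed by factors because these compose along a
  chain without any bound on the ratios; such a bound, needed to return to norms, comes only at the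
  end, from compactness.\<close>

lemma matrix_inv:
  fixes T :: "real^'d^'d"
  assumes "invertible T"
  shows matrix_inv_right: "T ** matrix_inv T = mat 1"
    and matrix_inv_left: "matrix_inv T ** T = mat 1"
proof -
  have "T ** matrix_inv T = mat 1 \<and> matrix_inv T ** T = mat 1"
    using assms unfolding matrix_inv_def invertible_def by (rule someI_ex)
  then show "T ** matrix_inv T = mat 1" "matrix_inv T ** T = mat 1" by auto
qed

lemma matrix_inv_cancel:
  fixes T S :: "real^'d^'d"
  assumes "invertible T"
  shows "T ** (matrix_inv T ** S) = S" and "matrix_inv T ** (T ** S) = S"
  using matrix_inv[OF assms] by (metis matrix_mul_assoc matrix_mul_lid)+

lemma matrix_inv_unique:
  fixes T S :: "real^'d^'d"
  assumes "S ** T = mat 1"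
  shows "matrix_inv T = S"
proof -
  have "invertible T" using assms by (auto simp: invertible_left_inverse)
  then have "S ** T ** matrix_inv T = S"
    by (simp add: matrix_mul_assoc[symmetric] matrix_inv)
  then show ?thesis using assms by (simp add: matrix_mul_lid)
qed

lemma invertible_matrix_inv:
  fixes T :: "real^'d^'d"
  shows "invertible T \<Longrightarrow> invertible (matrix_inv T)"
  using matrix_inv invertible_def by blast

lemma matrix_inv_mult:
  fixes S T :: "real^'d^'d"
  assumes "invertible S" "invertible T"
  shows "matrix_inv (S ** T) = matrix_inv T ** matrix_inv S"
  by (rule matrix_inv_unique)
    (simp add: assms matrix_mul_assoc[symmetric] matrix_inv_cancel matrix_inv)

lemma matrix_inv_matrix_inv:
  fixes T :: "real^'d^'d"
  shows "invertible T \<Longrightarrow> matrix_inv (matrix_inv T) = T"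
  by (rule matrix_inv_unique) (simp add: matrix_inv)

lemma invertible_mat_1: "invertible (mat 1 :: real^'d^'d)"
  by (auto simp: invertible_def)

lemma matrix_inv_mat_1: "matrix_inv (mat 1 :: real^'d^'d) = mat 1"
  by (rule matrix_inv_unique) simp

lemmas gl_simps = matrix_mul_assoc[symmetric] matrix_inv_cancel matrix_inv matrix_inv_mult
  matrix_inv_matrix_inv invertible_matrix_inv invertible_mult invertible_mat_1 matrix_inv_mat_1

section \<open>Operator norm estimates and comparison with the Frobenius norm\<close>

lemma opnorm_nonneg: "0 \<le> opnorm (T :: real^'d^'d)"
  by (rule onorm_pos_le) (rule matrix_vector_mul_bounded_linear)

lemma opnorm_mult: "opnorm (S ** T) \<le> opnorm S * opnorm (T :: real^'d^'d)"
  using onorm_compose[of "(*v) S" "(*v) T"]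
  by (simp add: o_def matrix_vector_mul_assoc matrix_vector_mul_bounded_linear)

lemma opnorm_add: "opnorm (S + T) \<le> opnorm S + opnorm (T :: real^'d^'d)"
  using onorm_triangle[of "(*v) S" "(*v) T"]
  by (simp add: matrix_vector_mult_add_rdistrib matrix_vector_mul_bounded_linear)

lemma opnorm_mat_1: "opnorm (mat 1 :: real^'d^'d) \<le> 1"
  using onorm_id_le by simp

lemma opnorm_uminus: "opnorm (- T) = opnorm (T :: real^'d^'d)"
proof -
  have "(- T) *v v = - (T *v v)" for v
    using matrix_vector_mult_diff_rdistrib[of 0 T v] by simp
  then show ?thesis by (simp add: onorm_neg)
qed

lemma opnorm_minus_commute: "opnorm (S - T) = opnorm (T - S :: real^'d^'d)"
  using opnorm_uminus[of "S - T"] by simp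

lemma opnorm_triangle_ineq2: "opnorm S \<le> opnorm (S - T) + opnorm (T :: real^'d^'d)"
  using opnorm_add[of "S - T" T] by simp

lemma norm_le_opnorm: "norm T \<le> real CARD('d) * real CARD('d) * opnorm (T :: real^'d^'d)"
proof -
  have row: "norm (T $ i) \<le> real CARD('d) * opnorm T" for i
  proof -
    have "norm (T $ i) \<le> (\<Sum>j\<in>UNIV. \<bar>T $ i $ j\<bar>)" by (rule norm_le_l1_cart)
    also have "\<dots> \<le> (\<Sum>j\<in>(UNIV :: 'd set). opnorm T)"
      by (intro sum_mono) (rule matrix_component_le_onorm)
    finally show ?thesis by simp
  qed
  have "norm T \<le> (\<Sum>i\<in>UNIV. norm (T $ i))"
    unfolding norm_vec_def by (rule L2_set_le_sum) simp
  also have "\<dots> \<le> (\<Sum>i\<in>(UNIV :: 'd set). real CARD('d) * opnorm T)"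
    by (intro sum_mono row)
  finally show ?thesis by simp
qed

lemma opnorm_le_norm: "opnorm T \<le> real CARD('d) * real CARD('d) * norm (T :: real^'d^'d)"
proof (rule onorm_le_matrix_component)
  show "\<bar>T $ i $ j\<bar> \<le> norm T" for i j
    using component_le_norm_cart[of "T $ i" j] Finite_Cartesian_Product.norm_nth_le[of T i] by linarith
qed

lemma matrix_diff_distrib:
  fixes S T U :: "real^'d^'d"
  shows "U ** (S - T) = U ** S - U ** T" and "(S - T) ** U = S ** U - T ** U"
  by (vector matrix_matrix_mult_def sum_subtractf algebra_simps)+

lemma continuous_on_opnorm:
  fixes g :: "'b::topological_space \<Rightarrow> real^'d^'d"
  assumes "continuous_on S g"
  shows "continuous_on S (\<lambda>x. opnorm (g x))"
proof -
  define c where "c = real CARD('d) * real CARD('d)"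
  have "c-lipschitz_on UNIV (\<lambda>T :: real^'d^'d. opnorm T)"
  proof (rule lipschitz_onI)
    fix S T :: "real^'d^'d"
    have "\<bar>opnorm S - opnorm T\<bar> \<le> opnorm (S - T)"
      using opnorm_triangle_ineq2[of S T] opnorm_triangle_ineq2[of T S]
      by (simp add: opnorm_minus_commute)
    also have "\<dots> \<le> c * norm (S - T)" unfolding c_def by (rule opnorm_le_norm)
    finally show "dist (opnorm S) (opnorm T) \<le> c * dist S T" by (simp add: dist_norm)
  qed (simp add: c_def)
  then have "continuous_on UNIV (\<lambda>T :: real^'d^'d. opnorm T)"
    by (rule lipschitz_on_continuous_on)
  from continuous_on_compose2[OF this assms] show ?thesis by simp
qed

lemma tendsto_opnorm_diff_0:
  fixes g :: "'b \<Rightarrow> real^'d^'d"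
  assumes "((\<lambda>x. opnorm (g x - T)) \<longlongrightarrow> 0) F"
  shows "(g \<longlongrightarrow> T) F"
proof -
  have "((\<lambda>x. real CARD('d) * real CARD('d) * opnorm (g x - T)) \<longlongrightarrow> 0) F"
    using tendsto_mult_right_zero[OF assms] .
  then have "((\<lambda>x. g x - T) \<longlongrightarrow> 0) F"
    by (rule Lim_null_comparison[rotated]) (simp add: norm_le_opnorm)
  then show ?thesis by (simp add: LIM_zero_cancel)
qed

lemma continuous_on_opnorm_modulus:
  fixes g :: "'a::metric_space \<Rightarrow> real^'d^'d"
  assumes "\<And>x y. opnorm (g x - g y) \<le> c * dist x y powr \<nu>" and "\<nu> > 0"
  shows "continuous_on UNIV g"
proof (unfold continuous_on_def, intro ballI)
  fix y :: 'a
  have "((\<lambda>x. c * dist x y powr \<nu>) \<longlongrightarrow> c * dist y y powr \<nu>) (at y)"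
    using assms(2) by (intro tendsto_intros) auto
  then have *: "((\<lambda>x. c * dist x y powr \<nu>) \<longlongrightarrow> 0) (at y)" by simp
  show "(g \<longlongrightarrow> g y) (at y)"
    by (rule tendsto_opnorm_diff_0, rule tendsto_sandwich[OF _ _ tendsto_const *])
      (simp_all add: opnorm_nonneg assms(1))
qed

text \<open>Factors appear on both sides because changing the base point of a ratio alters its
  \<open>A\<close> part on the left and its \<open>B\<close> part on the right. The bound
  \<open>exp k - 1\<close> makes parameters additive under composition, since
  \<open>(1 + (exp a - 1)) * (1 + (exp b - 1)) = exp (a + b)\<close>. The relation is directed, so
  later chains fix the orientation of each link.\<close>

definition near_by :: "real \<Rightarrow> real^'d^'d \<Rightarrow> real^'d^'d \<Rightarrow> bool" where
  "near_by k X Y \<longleftrightarrow> (\<exists>U V. X = U ** Y ** V \<and>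
     opnorm (U - mat 1) \<le> exp k - 1 \<and> opnorm (V - mat 1) \<le> exp k - 1)"

lemma opnorm_mult_minus_mat_1:
  fixes U V :: "real^'d^'d"
  assumes "opnorm (U - mat 1) \<le> exp a - 1" "opnorm (V - mat 1) \<le> exp b - 1"
  shows "opnorm (U ** V - mat 1) \<le> exp (a + b) - 1"
proof -
  have "U ** V - mat 1 = (U - mat 1) ** (V - mat 1) + (U - mat 1) + (V - mat 1)"
    unfolding matrix_diff_distrib by simp
  also have "opnorm \<dots> \<le> opnorm (U - mat 1) * opnorm (V - mat 1) + opnorm (U - mat 1) + opnorm (V - mat 1)"
    using opnorm_add[of "(U - mat 1) ** (V - mat 1) + (U - mat 1)" "V - mat 1"]
      opnorm_add[of "(U - mat 1) ** (V - mat 1)" "U - mat 1"] opnorm_mult[of "U - mat 1" "V - mat 1"]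
    by linarith
  also have "\<dots> \<le> (exp a - 1) * (exp b - 1) + (exp a - 1) + (exp b - 1)"
    using mult_mono[OF assms] assms opnorm_nonneg[of "U - mat 1"] opnorm_nonneg[of "V - mat 1"]
    by linarith
  also have "\<dots> = exp (a + b) - 1" by (simp add: exp_add algebra_simps)
  finally show ?thesis .
qed

lemma near_by_trans:
  assumes "near_by a X Y" "near_by b Y Z"
  shows "near_by (a + b) X Z"
proof -
  obtain U V where 1: "X = U ** Y ** V"
    "opnorm (U - mat 1) \<le> exp a - 1" "opnorm (V - mat 1) \<le> exp a - 1"
    using assms(1) by (auto simp: near_by_def)
  obtain U' V' where 2: "Y = U' ** Z ** V'"
    "opnorm (U' - mat 1) \<le> exp b - 1" "opnorm (V' - mat 1) \<le> exp b - 1"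
    using assms(2) by (auto simp: near_by_def)
  have "X = (U ** U') ** Z ** (V' ** V)" by (simp add: 1 2 matrix_mul_assoc)
  moreover have "opnorm (U ** U' - mat 1) \<le> exp (a + b) - 1"
    by (rule opnorm_mult_minus_mat_1[OF 1(2) 2(2)])
  moreover have "opnorm (V' ** V - mat 1) \<le> exp (a + b) - 1"
    using opnorm_mult_minus_mat_1[OF 2(3) 1(3)] by (simp add: add.commute)
  ultimately show ?thesis unfolding near_by_def by blast
qed

lemma near_by_mono:
  assumes "near_by a X Y" "a \<le> b"
  shows "near_by b X Y"
proof -
  have ab: "exp a - 1 \<le> exp b - 1" using assms(2) by simp
  obtain U V where UV: "X = U ** Y ** V"
    "opnorm (U - mat 1) \<le> exp a - 1" "opnorm (V - mat 1) \<le> exp a - 1"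
    using assms(1) by (auto simp: near_by_def)
  show ?thesis
    unfolding near_by_def using UV(1) order_trans[OF UV(2) ab] order_trans[OF UV(3) ab] by blast
qed

text \<open>The return from factors to norms. The estimate is relative to \<open>opnorm Y\<close>,
  so it yields a Hoelder bound only once the ratios are known to be bounded.\<close>

lemma near_by_opnorm_diff:
  assumes "near_by a X Y"
  shows "opnorm (X - Y) \<le> (exp (2 * a) - 1) * opnorm Y"
proof -
  obtain U V where 1: "X = U ** Y ** V"
    "opnorm (U - mat 1) \<le> exp a - 1" "opnorm (V - mat 1) \<le> exp a - 1"
    using assms by (auto simp: near_by_def)
  have a: "0 \<le> exp a - 1"
    using 1(2) opnorm_nonneg[of "U - mat 1"] by linarith
  have V: "opnorm V \<le> exp a"
    using opnorm_triangle_ineq2[of V "mat 1"] 1(3) opnorm_mat_1[where ?'d='a] by linarith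
  have "X - Y = (U - mat 1) ** Y ** V + Y ** (V - mat 1)"
    by (simp add: 1 matrix_diff_distrib)
  also have "opnorm \<dots> \<le> opnorm ((U - mat 1) ** Y ** V) + opnorm (Y ** (V - mat 1))"
    by (rule opnorm_add)
  also have "\<dots> \<le> (opnorm (U - mat 1) * opnorm Y) * opnorm V + opnorm Y * opnorm (V - mat 1)"
    by (meson opnorm_mult opnorm_nonneg mult_right_mono add_mono order_trans)
  also have "\<dots> \<le> ((exp a - 1) * opnorm Y) * exp a + opnorm Y * (exp a - 1)"
    using 1 V a opnorm_nonneg[of Y] opnorm_nonneg[of V] opnorm_nonneg[of "U - mat 1"]
      opnorm_nonneg[of "V - mat 1"]
    by (intro add_mono mult_mono mult_nonneg_nonneg) auto
  also have "\<dots> = (exp (2 * a) - 1) * opnorm Y"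
    using exp_add[of a a] by (simp add: algebra_simps)
  finally show ?thesis .
qed

text \<open>The quotient of two products is conjugated by partial products, so each factor's relative
  error is amplified by the condition number of the preceding partial product.\<close>

lemma opnorm_product_quotient:
  fixes c d g k :: "nat \<Rightarrow> real^'d^'d"
  assumes "c 0 = mat 1" "d 0 = mat 1"
    and c: "\<And>i. i < n \<Longrightarrow> c (Suc i) = g i ** c i"
    and d: "\<And>i. i < n \<Longrightarrow> d (Suc i) = k i ** d i"
    and inv: "\<And>i. invertible (d i)" "\<And>i. invertible (k i)"
    and e: "\<And>i. i < n \<Longrightarrow> opnorm (d i) * opnorm (matrix_inv (d i)) *
              (opnorm (matrix_inv (k i)) * opnorm (g i - k i)) \<le> e i"
  shows "opnorm (matrix_inv (d n) ** c n - mat 1) \<le> exp (\<Sum>i<n. e i) - 1"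
  using c d e
proof (induction n)
  case 0
  then show ?case by (simp add: assms gl_simps onorm_zero)
next
  case (Suc n)
  define h where "h = matrix_inv (d n) ** c n"
  define E where "E = (\<Sum>i<n. e i)"
  have IH: "opnorm (h - mat 1) \<le> exp E - 1"
    unfolding h_def E_def by (rule Suc.IH) (simp_all add: Suc.prems)
  have h: "opnorm h \<le> exp E"
    using opnorm_triangle_ineq2[of h "mat 1"] IH opnorm_mat_1[where ?'d='d] by linarith
  have en: "opnorm (d n) * opnorm (matrix_inv (d n)) *
              (opnorm (matrix_inv (k n)) * opnorm (g n - k n)) \<le> e n"
    by (simp add: Suc.prems)
  have e0: "0 \<le> e n"
    by (rule order_trans[OF _ en]) (intro mult_nonneg_nonneg opnorm_nonneg)
  have c_h: "c n = d n ** h" by (simp add: h_def gl_simps inv)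
  \<comment> \<open>The next quotient is \<open>h\<close> multiplied on the left by the conjugate
    under \<open>d n\<close> of \<open>matrix_inv (k n) ** g n\<close>; writing the latter as the
    identity plus \<open>matrix_inv (k n) ** (g n - k n)\<close> isolates the new error.\<close>
  have "matrix_inv (d (Suc n)) ** c (Suc n) - mat 1
      = matrix_inv (d n) ** (matrix_inv (k n) ** (g n - k n)) ** d n ** h + (h - mat 1)"
    by (simp add: Suc.prems gl_simps inv matrix_diff_distrib c_h)
  also have "opnorm \<dots> \<le> opnorm (matrix_inv (d n) ** (matrix_inv (k n) ** (g n - k n)) ** d n ** h)
      + opnorm (h - mat 1)" by (rule opnorm_add)
  also have "opnorm (matrix_inv (d n) ** (matrix_inv (k n) ** (g n - k n)) ** d n ** h)
      \<le> opnorm (matrix_inv (d n)) * (opnorm (matrix_inv (k n)) * opnorm (g n - k n)) * opnorm (d n)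
        * opnorm h"
    by (meson opnorm_mult opnorm_nonneg mult_right_mono mult_left_mono order_trans)
  also have "\<dots> \<le> e n * exp E"
    by (rule mult_mono) (use en h e0 in \<open>simp_all add: mult_ac opnorm_nonneg\<close>)
  also have "\<dots> \<le> (exp (e n) - 1) * exp E"
    using exp_ge_add_one_self[of "e n"] by (intro mult_right_mono) (linarith, simp)
  finally show ?case using IH by (simp add: E_def[symmetric] exp_add algebra_simps)
qed

text \<open>The constant \<open>K\<close> survives because the estimate passes to limits along
  \<open>s\<close>. Invertibility of the values could be lost in the limit and is recovered
  separately.\<close>

lemma dense_sequence_extension:
  fixes s :: "nat \<Rightarrow> 'a::metric_space" and p :: "nat \<Rightarrow> real^'d^'d"
  assumes dense: "closure (range s) = UNIV" and "\<nu> > 0" and "K > 0"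
    and p: "\<And>i j. opnorm (p i - p j) \<le> K * dist (s i) (s j) powr \<nu>"
  shows "\<exists>P. (\<forall>i. P (s i) = p i) \<and> (\<forall>x y. opnorm (P x - P y) \<le> K * dist x y powr \<nu>)"
proof -
  define c where "c = real CARD('d) * real CARD('d)"
  have c: "c > 0" by (simp add: c_def)
  have norm_le: "norm T \<le> c * opnorm T" for T :: "real^'d^'d"
    unfolding c_def by (rule norm_le_opnorm)
  \<comment> \<open>\<open>s\<close> may repeat values, so some index is chosen; the bound at
    distance 0 forces \<open>p\<close> to agree on all indices of one point.\<close>
  define g where "g = (\<lambda>x. p (SOME i. s i = x))"
  have g: "g (s i) = p i" for i
  proof -
    have "s (SOME j. s j = s i) = s i" by (rule someI) simp
    then have "opnorm (g (s i) - p i) \<le> 0"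
      using p[of "SOME j. s j = s i" i] by (simp add: g_def)
    then have "opnorm (g (s i) - p i) = 0" using opnorm_nonneg[of "g (s i) - p i"] by linarith
    then have "norm (g (s i) - p i) \<le> 0" using norm_le[of "g (s i) - p i"] by simp
    then show ?thesis by simp
  qed
  have "uniformly_continuous_on (range s) g"
    unfolding uniformly_continuous_on_def
  proof (intro allI impI)
    fix e :: real assume e: "e > 0"
    \<comment> \<open>Solves \<open>c * K * d powr \<nu> = e / 2\<close>, where \<open>c\<close> is
      the cost of passing from the operator norm to the Frobenius norm.\<close>
    define d where "d = (e / (2 * c * K)) powr (1 / \<nu>)"
    have d: "d > 0" using e c assms by (simp add: d_def)
    have dist_g: "dist (g y) (g x) < e" if "x \<in> range s" "y \<in> range s" "dist y x < d" for x y
    proof -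
      obtain i j where ij: "x = s i" "y = s j" using \<open>x \<in> range s\<close> \<open>y \<in> range s\<close> by auto
      have "dist (g y) (g x) \<le> c * opnorm (p j - p i)"
        using norm_le[of "p j - p i"] by (simp add: dist_norm ij g)
      also have "\<dots> \<le> c * (K * dist y x powr \<nu>)"
        unfolding ij using c p[of j i] by (intro mult_left_mono) auto
      also have "\<dots> \<le> c * (K * d powr \<nu>)"
        using c assms that by (intro mult_left_mono powr_mono2) auto
      also have "d powr \<nu> = e / (2 * c * K)"
        using assms e c by (simp add: d_def powr_powr)
      also have "c * (K * (e / (2 * c * K))) < e" using assms e c by simp
      finally show ?thesis .
    qed
    then show "\<exists>d>0. \<forall>x\<in>range s. \<forall>x'\<in>range s. dist x' x < d \<longrightarrow> dist (g x') (g x) < e"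
      using d by blast
  qed
  then obtain P where P: "uniformly_continuous_on (closure (range s)) P" "\<And>x. x \<in> range s \<Longrightarrow> g x = P x"
    using uniformly_continuous_on_extension_on_closure by metis
  have cont: "continuous_on UNIV P"
    using P(1) dense uniformly_continuous_imp_continuous by force
  have Ps: "P (s i) = p i" for i using P(2)[of "s i"] g by simp
  have "opnorm (P x - P y) \<le> K * dist x y powr \<nu>" for x y
  proof -
    have "\<exists>i. (\<lambda>k. s (i k)) \<longlonglongrightarrow> z" for z
    proof -
      obtain u where u: "\<And>k. u k \<in> range s" "u \<longlonglongrightarrow> z"
        using dense closure_sequential[of z "range s"] by auto
      have "\<forall>k. \<exists>i. u k = s i" using u(1) by blast
      then obtain i where "\<forall>k. u k = s (i k)" by metis
      then have "u = (\<lambda>k. s (i k))" by blast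
      then show ?thesis using u(2) by blast
    qed
    then obtain i j where ij: "(\<lambda>k. s (i k)) \<longlonglongrightarrow> x" "(\<lambda>k. s (j k)) \<longlonglongrightarrow> y" by blast
    have "continuous_on UNIV (\<lambda>T :: real^'d^'d. opnorm T)"
      by (rule continuous_on_opnorm) (rule continuous_on_id)
    moreover have "(\<lambda>k. P (s (i k)) - P (s (j k))) \<longlonglongrightarrow> P x - P y"
      using continuous_on_tendsto_compose[OF cont ij(1)] continuous_on_tendsto_compose[OF cont ij(2)]
      by (intro tendsto_diff) simp_all
    ultimately have "(\<lambda>k. opnorm (P (s (i k)) - P (s (j k)))) \<longlonglongrightarrow> opnorm (P x - P y)"
      using continuous_on_tendsto_compose by fastforce
    moreover have "(\<lambda>k. K * dist (s (i k)) (s (j k)) powr \<nu>) \<longlonglongrightarrow> K * dist x y powr \<nu>"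
      using assms(2) by (intro tendsto_intros tendsto_dist ij tendsto_powr2) auto
    ultimately show ?thesis
      by (rule LIMSEQ_le) (simp add: Ps p)
  qed
  then show ?thesis using Ps by blast
qed

lemma continuous_eq_on_dense:
  fixes F G :: "'a::topological_space \<Rightarrow> 'b::t2_space"
  assumes "continuous_on UNIV F" "continuous_on UNIV G" "closure S = UNIV"
    and "\<And>x. x \<in> S \<Longrightarrow> F x = G x"
  shows "F x = G x"
proof -
  have "closed {x. F x = G x}" using assms(1,2) by (rule closed_Collect_eq)
  then have "closure S \<subseteq> {x. F x = G x}" using assms(4) by (intro closure_minimal) auto
  then show ?thesis using assms(3) by auto
qed

lemma continuous_on_matrix_mult:
  fixes F G :: "'a::topological_space \<Rightarrow> real^'d^'d"
  assumes "continuous_on S F" "continuous_on S G"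
  shows "continuous_on S (\<lambda>x. F x ** G x)"
  unfolding matrix_matrix_mult_def using assms by (intro continuous_intros)

lemma exp_minus_one_le: "exp t - 1 \<le> t * exp (t :: real)"
proof -
  have "(1 - t) * exp t \<le> exp (- t) * exp t"
    using exp_ge_add_one_self[of "- t"] by (intro mult_right_mono) auto
  then show ?thesis by (simp add: exp_minus algebra_simps)
qed

section \<open>Twisted cocycles\<close>

lemma int_iterate_add:
  assumes "bij f"
  shows "int_iterate f (m + n) x = int_iterate f m (int_iterate f n x)"
proof -
  have step: "int_iterate f (k + 1) y = f (int_iterate f k y)" for k y
  proof (cases "k \<ge> 0")
    case True
    then show ?thesis by (simp add: int_iterate_def nat_add_distrib)
  next
    case False
    then have "nat (- k) = Suc (nat (- (k + 1)))" by linarith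
    with False assms show ?thesis
      by (auto simp: int_iterate_def bij_is_surj surj_f_inv_f)
  qed
  have "int_iterate f (m + n) x = int_iterate f m (int_iterate f n x)" for m
  proof (induction m rule: int_induct[where k=0])
    case base
    then show ?case by (simp add: int_iterate_def)
  next
    case (step1 i)
    then show ?case using step[of "i + n" x] step[of i] by (simp add: algebra_simps)
  next
    case (step2 i)
    have "f (int_iterate f (i - 1 + n) x) = f (int_iterate f (i - 1) (int_iterate f n x))"
      using step[of "i - 1 + n" x] step[of "i - 1"] step2 by (simp add: algebra_simps)
    then show ?case using assms by (meson bij_is_inj injD)
  qed
  then show ?thesis .
qed

lemma int_iterate_0: "int_iterate f 0 x = x"
  by (simp add: int_iterate_def)

lemma int_iterate_1: "int_iterate f 1 x = f x"
  by (simp add: int_iterate_def)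

lemma int_iterate_of_nat: "int_iterate f (int n) x = (f ^^ n) x"
  by (simp add: int_iterate_def)

lemma carrier_GL: "T \<in> carrier GL \<longleftrightarrow> invertible T"
  by (simp add: GL_def)

section \<open>Powers of the twisting automorphism on invertible matrices\<close>

locale twisting =
  fixes f :: "'a \<Rightarrow> 'a" and \<alpha> :: "real^'d^'d \<Rightarrow> real^'d^'d"
  assumes bij: "bij f" and aut: "\<alpha> \<in> carrier (AutoGroup GL)"
begin

lemma aut_pow_carrier: "aut_pow \<alpha> n \<in> carrier (AutoGroup GL)"
  by (rule group.int_pow_closed[OF group.AutoGroup[OF group_GL] aut])

lemma aut_pow_invertible: "invertible T \<Longrightarrow> invertible (aut_pow \<alpha> n T)"
  using aut_pow_carrier[of n]
  by (auto simp: AutoGroup_def BijGroup_def auto_def Bij_def bij_betw_def carrier_GL[symmetric])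

lemma aut_pow_mult:
  "invertible S \<Longrightarrow> invertible T \<Longrightarrow> aut_pow \<alpha> n (S ** T) = aut_pow \<alpha> n S ** aut_pow \<alpha> n T"
  using aut_pow_carrier[of n]
  by (auto simp: AutoGroup_def BijGroup_def auto_def hom_def GL_def)

lemma aut_pow_add:
  assumes "invertible T"
  shows "aut_pow \<alpha> m (aut_pow \<alpha> n T) = aut_pow \<alpha> (m + n) T"
proof -
  have "aut_pow \<alpha> (m + n) = aut_pow \<alpha> m \<otimes>\<^bsub>AutoGroup GL\<^esub> aut_pow \<alpha> n"
    by (rule group.int_pow_mult[OF group.AutoGroup[OF group_GL] aut])
  moreover have "aut_pow \<alpha> k \<in> Bij (carrier GL)" for k
    using aut_pow_carrier[of k] by (simp add: AutoGroup_def auto_def)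
  ultimately show ?thesis
    using assms by (simp add: AutoGroup_def BijGroup_def compose_def carrier_GL)
qed

lemma aut_pow_0: "invertible T \<Longrightarrow> aut_pow \<alpha> 0 T = T"
  by (simp add: AutoGroup_def BijGroup_def carrier_GL)

lemma AutoGroup_one: "invertible T \<Longrightarrow> \<one>\<^bsub>AutoGroup GL\<^esub> T = T"
  by (simp add: AutoGroup_def BijGroup_def carrier_GL)

lemma aut_pow_1: "aut_pow \<alpha> 1 = \<alpha>"
  by (rule group.int_pow_1[OF group.AutoGroup[OF group_GL] aut])

text \<open>Oriented towards powers, so that \<alpha> can be merged with other exponents by
  \<open>aut_pow_add\<close>.\<close>

lemma aut_pow_1_apply: "\<alpha> T = aut_pow \<alpha> 1 T"
  by (simp add: aut_pow_1)

lemma \<alpha>_mult: "invertible S \<Longrightarrow> invertible T \<Longrightarrow> \<alpha> (S ** T) = \<alpha> S ** \<alpha> T"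
  using aut_pow_mult[of S T 1] by (simp add: aut_pow_1)

lemma aut_pow_mat_1: "aut_pow \<alpha> n (mat 1) = mat 1"
proof -
  have "aut_pow \<alpha> n (mat 1) ** aut_pow \<alpha> n (mat 1) = aut_pow \<alpha> n (mat 1)"
    using aut_pow_mult[of "mat 1" "mat 1" n] by (simp add: invertible_mat_1)
  then show ?thesis
    by (metis aut_pow_invertible invertible_mat_1 matrix_inv_cancel(2) matrix_inv_left)
qed

lemma aut_pow_inv:
  assumes "invertible T"
  shows "aut_pow \<alpha> n (matrix_inv T) = matrix_inv (aut_pow \<alpha> n T)"
proof (rule sym, rule matrix_inv_unique)
  show "aut_pow \<alpha> n (matrix_inv T) ** aut_pow \<alpha> n T = mat 1"
    by (simp add: aut_pow_mult[symmetric] assms gl_simps aut_pow_mat_1)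
qed

lemmas aut_simps = aut_pow_invertible aut_pow_mult aut_pow_add aut_pow_0 AutoGroup_one aut_pow_mat_1 aut_pow_inv

text \<open>Integer times replace the truncated subtraction of the definition. Inside the fold
  \<open>i < n\<close>, so nothing is truncated, and times can then be shifted freely in the
  recursions.\<close>

lemma forward_cocycle_altdef:
  "forward_cocycle f \<alpha> A n x =
     foldr (\<lambda>i T. aut_pow \<alpha> (int i) (A (int_iterate f (int n - 1 - int i) x)) ** T) [0..<n] (mat 1)"
proof -
  have "aut_pow \<alpha> (int i) (A ((f ^^ (n - 1 - i)) x)) ** T
      = aut_pow \<alpha> (int i) (A (int_iterate f (int n - 1 - int i) x)) ** T" if "i \<in> set [0..<n]" for i T
  proof -
    have "int (n - 1 - i) = int n - 1 - int i" using that by auto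
    then show ?thesis by (metis int_iterate_of_nat)
  qed
  then show ?thesis unfolding forward_cocycle_def by (intro foldr_cong) auto
qed

text \<open>Powers of \<alpha> are multiplicative on invertible matrices, so invertibility of the
  tail is carried through the same induction as the other two claims.\<close>

lemma foldr_mult_GL:
  assumes "\<And>i. i \<in> set xs \<Longrightarrow> invertible (g i)"
  shows "invertible (foldr (\<lambda>i T. g i ** T) xs (mat 1))"
    and "invertible S \<Longrightarrow> foldr (\<lambda>i T. g i ** T) xs S = foldr (\<lambda>i T. g i ** T) xs (mat 1) ** S"
    and "aut_pow \<alpha> n (foldr (\<lambda>i T. g i ** T) xs (mat 1))
      = foldr (\<lambda>i T. aut_pow \<alpha> n (g i) ** T) xs (mat 1)"
proof -
  have *: "invertible (foldr (\<lambda>i T. g i ** T) xs (mat 1))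
     \<and> (invertible S \<longrightarrow> foldr (\<lambda>i T. g i ** T) xs S = foldr (\<lambda>i T. g i ** T) xs (mat 1) ** S)
     \<and> aut_pow \<alpha> n (foldr (\<lambda>i T. g i ** T) xs (mat 1))
      = foldr (\<lambda>i T. aut_pow \<alpha> n (g i) ** T) xs (mat 1)"
    using assms by (induction xs) (auto simp: gl_simps aut_simps)
  from * show "invertible (foldr (\<lambda>i T. g i ** T) xs (mat 1))"
    "invertible S \<Longrightarrow> foldr (\<lambda>i T. g i ** T) xs S = foldr (\<lambda>i T. g i ** T) xs (mat 1) ** S"
    "aut_pow \<alpha> n (foldr (\<lambda>i T. g i ** T) xs (mat 1))
      = foldr (\<lambda>i T. aut_pow \<alpha> n (g i) ** T) xs (mat 1)" by auto
qed

section \<open>The one-step recursion and the cocycle identity\<close>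

context
  fixes A :: "'a \<Rightarrow> real^'d^'d"
  assumes inv: "\<And>x. invertible (A x)"
begin

lemma forward_cocycle_invertible: "invertible (forward_cocycle f \<alpha> A n x)"
  unfolding forward_cocycle_altdef by (rule foldr_mult_GL) (simp add: aut_simps inv)

lemma forward_cocycle_Suc_left:
  "forward_cocycle f \<alpha> A (Suc n) x
     = A (int_iterate f (int n) x) ** \<alpha> (forward_cocycle f \<alpha> A n x)"
proof -
  have "[0..<Suc n] = 0 # map Suc [0..<n]" by (simp add: map_Suc_upt upt_conv_Cons del: upt_Suc)
  then have "forward_cocycle f \<alpha> A (Suc n) x
      = A (int_iterate f (int n) x) **
        foldr (\<lambda>i T. aut_pow \<alpha> (1 + int i) (A (int_iterate f (int n - 1 - int i) x)) ** T) [0..<n] (mat 1)"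
    by (simp add: forward_cocycle_altdef foldr_map o_def aut_simps inv del: upt_Suc)
       (simp add: algebra_simps)
  also have "foldr (\<lambda>i T. aut_pow \<alpha> (1 + int i) (A (int_iterate f (int n - 1 - int i) x)) ** T) [0..<n] (mat 1)
     = aut_pow \<alpha> 1 (forward_cocycle f \<alpha> A n x)"
    unfolding forward_cocycle_altdef
    by (subst foldr_mult_GL(3)) (simp_all add: aut_simps inv)
  finally show ?thesis by (simp add: aut_pow_1)
qed

text \<open>Splits off the oldest factor. Negative times require it: lowering the time moves the
  starting point of the inverted product one step back.\<close>

lemma forward_cocycle_Suc_right:
  "forward_cocycle f \<alpha> A (Suc n) x
     = forward_cocycle f \<alpha> A n (f x) ** aut_pow \<alpha> (int n) (A x)"
proof -
  have shift: "int_iterate f (int n - 1 - int i) (f x) = int_iterate f (int n - int i) x" for i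
    using int_iterate_add[OF bij, of "int n - 1 - int i" 1 x] by (simp add: int_iterate_1)
  show ?thesis
    unfolding forward_cocycle_altdef
    apply (simp add: shift int_iterate_0)
    apply (subst foldr_mult_GL(2))
      apply (simp_all add: aut_simps inv)
    done
qed

lemma twisted_cocycle_invertible: "invertible (twisted_cocycle f \<alpha> A n x)"
  by (simp add: twisted_cocycle_def forward_cocycle_invertible aut_simps gl_simps)

lemma twisted_cocycle_0: "twisted_cocycle f \<alpha> A 0 x = mat 1"
  by (simp add: twisted_cocycle_def forward_cocycle_def)

lemma twisted_cocycle_Suc:
  "twisted_cocycle f \<alpha> A (n + 1) x = A (int_iterate f n x) ** \<alpha> (twisted_cocycle f \<alpha> A n x)"
proof (cases "n \<ge> 0")
  case True
  then show ?thesis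
    using forward_cocycle_Suc_left[of "nat n" x] by (simp add: twisted_cocycle_def nat_add_distrib)
next
  case False
  \<comment> \<open>\<open>n = -(k + 1)\<close>, so the product inverted at time \<open>n\<close>
    starts at \<open>u\<close> and has \<open>k + 1\<close> factors. \<open>F\<close> collects all
    but the one at \<open>u\<close> and is exactly the product inverted at time
    \<open>n + 1\<close>.\<close>
  define k where "k = nat (- n - 1)"
  have n: "n = - int (Suc k)" using False by (simp add: k_def)
  define u where "u = int_iterate f n x"
  have fu: "int_iterate f (n + 1) x = f u"
    using int_iterate_add[OF bij, of 1 n x] by (simp add: u_def int_iterate_1 add.commute)
  define F where "F = forward_cocycle f \<alpha> A k (f u)"
  have F: "invertible F" unfolding F_def by (rule forward_cocycle_invertible)
  have 1: "twisted_cocycle f \<alpha> A (n + 1) x = aut_pow \<alpha> (- int k) (matrix_inv F)"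
  proof (cases "k = 0")
    case True
    then have "F = mat 1" by (simp add: F_def forward_cocycle_def)
    then show ?thesis using True by (simp add: n twisted_cocycle_0 gl_simps aut_simps)
  next
    case False
    then show ?thesis using fu by (simp add: F_def twisted_cocycle_def n)
  qed
  have "twisted_cocycle f \<alpha> A n x
      = aut_pow \<alpha> n (matrix_inv (F ** aut_pow \<alpha> (int k) (A u)))"
    using forward_cocycle_Suc_right[of k u]
    by (simp add: twisted_cocycle_def n F_def u_def del: of_nat_Suc)
  then have "\<alpha> (twisted_cocycle f \<alpha> A n x)
      = aut_pow \<alpha> 1 (aut_pow \<alpha> n (matrix_inv (F ** aut_pow \<alpha> (int k) (A u))))"
    by (simp add: aut_pow_1)
  also have "\<dots> = matrix_inv (A u) ** aut_pow \<alpha> (- int k) (matrix_inv F)"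
    using n by (simp add: aut_simps gl_simps F inv)
  finally show ?thesis
    unfolding 1 u_def[symmetric] by (simp add: gl_simps inv)
qed

text \<open>The recursion determines its solution in both directions, because \<open>A\<close> is
  invertible and \<alpha> can be undone on invertible matrices. The cocycle identity and the final
  conjugacy formula both follow by checking a single step.\<close>

lemma twisted_cocycle_eqI:
  assumes "X 0 = mat 1" and "\<And>n. invertible (X n)"
    and "\<And>n. X (n + 1) = A (int_iterate f n x) ** \<alpha> (X n)"
  shows "X n = twisted_cocycle f \<alpha> A n x"
proof (induction n rule: int_induct[where k=0])
  case base
  then show ?case by (simp add: assms(1) twisted_cocycle_0)
next
  case (step1 i)
  then show ?case by (simp add: assms(3) twisted_cocycle_Suc)
next
  case (step2 i)
  let ?a = "A (int_iterate f (i - 1) x)"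
  have "?a ** \<alpha> (X (i - 1)) = ?a ** \<alpha> (twisted_cocycle f \<alpha> A (i - 1) x)"
    using assms(3)[of "i - 1"] twisted_cocycle_Suc[of "i - 1" x] step2 by simp
  then have "aut_pow \<alpha> 1 (X (i - 1)) = aut_pow \<alpha> 1 (twisted_cocycle f \<alpha> A (i - 1) x)"
    unfolding aut_pow_1 by (metis matrix_inv_cancel(2) inv)
  then have "aut_pow \<alpha> (- 1) (aut_pow \<alpha> 1 (X (i - 1)))
      = aut_pow \<alpha> (- 1) (aut_pow \<alpha> 1 (twisted_cocycle f \<alpha> A (i - 1) x))" by simp
  then show ?case by (simp add: aut_simps assms(2) twisted_cocycle_invertible)
qed

lemma twisted_cocycle_add:
  "twisted_cocycle f \<alpha> A (m + n) x
     = twisted_cocycle f \<alpha> A n (int_iterate f m x) ** aut_pow \<alpha> n (twisted_cocycle f \<alpha> A m x)"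
proof -
  let ?t = "twisted_cocycle f \<alpha> A"
  have "?t (m + n) x ** matrix_inv (aut_pow \<alpha> n (?t m x)) = ?t n (int_iterate f m x)"
  proof (rule twisted_cocycle_eqI)
    fix k
    show "invertible (?t (m + k) x ** matrix_inv (aut_pow \<alpha> k (?t m x)))"
      by (simp add: gl_simps aut_simps twisted_cocycle_invertible)
    have "?t (m + (k + 1)) x = A (int_iterate f k (int_iterate f m x)) ** aut_pow \<alpha> 1 (?t (m + k) x)"
      using twisted_cocycle_Suc[of "m + k" x] int_iterate_add[OF bij, of k m x]
      by (simp only: add.assoc add.commute[of k m] aut_pow_1)
    then show "?t (m + (k + 1)) x ** matrix_inv (aut_pow \<alpha> (k + 1) (?t m x))
        = A (int_iterate f k (int_iterate f m x))
          ** \<alpha> (?t (m + k) x ** matrix_inv (aut_pow \<alpha> k (?t m x)))"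
      by (simp only: aut_pow_1_apply) (simp add: gl_simps aut_simps twisted_cocycle_invertible add.commute)
  qed (simp add: gl_simps aut_simps twisted_cocycle_invertible)
  then show ?thesis
    by (metis aut_pow_invertible matrix_inv_left matrix_mul_assoc matrix_mul_rid
        twisted_cocycle_invertible)
qed

end

text \<open>Pulling back moves the twist into the factors: these matrices form an ordinary left
  product whose factor at step \<open>n\<close> is
  \<open>aut_pow \<alpha> (- (n + 1)) (A (int_iterate f n x))\<close>. Part (i) of fiber-bunching
  bounds their condition numbers.\<close>

definition untwisted :: "('a \<Rightarrow> real^'d^'d) \<Rightarrow> int \<Rightarrow> 'a \<Rightarrow> real^'d^'d" where
  "untwisted A n x = aut_pow \<alpha> (- n) (twisted_cocycle f \<alpha> A n x)"

definition ratio :: "('a \<Rightarrow> real^'d^'d) \<Rightarrow> ('a \<Rightarrow> real^'d^'d) \<Rightarrow> int \<Rightarrow> 'a \<Rightarrow> real^'d^'d" where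
  "ratio A B n x = matrix_inv (untwisted A n x) ** untwisted B n x"

lemma untwisted_invertible: "(\<And>x. invertible (A x)) \<Longrightarrow> invertible (untwisted A n x)"
  by (simp add: untwisted_def aut_simps twisted_cocycle_invertible)

lemma untwisted_0: "untwisted A 0 x = mat 1"
  by (simp add: untwisted_def twisted_cocycle_def forward_cocycle_def aut_simps gl_simps)

lemma untwisted_Suc:
  assumes "\<And>x. invertible (A x)"
  shows "untwisted A (n + 1) x = aut_pow \<alpha> (- (n + 1)) (A (int_iterate f n x)) ** untwisted A n x"
  by (simp add: untwisted_def twisted_cocycle_Suc[OF assms])
     (simp only: aut_pow_1_apply, simp add: assms aut_simps twisted_cocycle_invertible)

lemma untwisted_pred:
  assumes "\<And>x. invertible (A x)"
  shows "untwisted A (n - 1) x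
    = aut_pow \<alpha> (- n) (matrix_inv (A (int_iterate f (n - 1) x))) ** untwisted A n x"
  using untwisted_Suc[of A "n - 1" x, OF assms] by (simp add: assms aut_simps gl_simps)

text \<open>Passing from time \<open>m\<close> to time \<open>n\<close> multiplies each untwisted
  product on the left by an image of the cocycle over the closed loop at
  \<open>int_iterate f m x\<close>. This factor is common to \<open>A\<close> and \<open>B\<close>
  and cancels in the ratio.\<close>

lemma ratio_periodic:
  assumes "\<And>x. invertible (A x)" "\<And>x. invertible (B x)"
    and periodic: "\<And>n p. int_iterate f n p = p \<Longrightarrow> twisted_cocycle f \<alpha> A n p = twisted_cocycle f \<alpha> B n p"
    and eq: "int_iterate f m x = int_iterate f n x"
  shows "ratio A B m x = ratio A B n x"
proof -
  let ?u = "int_iterate f m x" and ?k = "n - m"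
  have "int_iterate f ?k ?u = ?u" using int_iterate_add[OF bij, of ?k m x] eq by simp
  then have *: "twisted_cocycle f \<alpha> A ?k ?u = twisted_cocycle f \<alpha> B ?k ?u" by (rule periodic)
  have "untwisted D n x = aut_pow \<alpha> (- n) (twisted_cocycle f \<alpha> D ?k ?u) ** untwisted D m x"
    if "\<And>x. invertible (D x)" for D
    using twisted_cocycle_add[of D m ?k x, OF that]
    by (simp add: untwisted_def aut_simps that twisted_cocycle_invertible)
  note this[of A, OF assms(1)] this[of B, OF assms(2)]
  then show ?thesis
    unfolding ratio_def
    by (simp add: * gl_simps aut_simps assms(1,2) untwisted_invertible twisted_cocycle_invertible)
qed

text \<open>The cocycle identity for the times \<open>n\<close> and \<open>-n\<close> makes the
  untwisted product seen backwards from \<open>int_iterate f n x\<close> the inverse of the cocycle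
  at \<open>x\<close>. This turns the candidate \<open>P\<close> along an orbit into a quotient of
  cocycles.\<close>

lemma ratio_uminus_iterate:
  assumes "\<And>x. invertible (A x)" "\<And>x. invertible (B x)"
  shows "ratio A B (- n) (int_iterate f n x)
    = twisted_cocycle f \<alpha> A n x ** matrix_inv (twisted_cocycle f \<alpha> B n x)"
proof -
  have "untwisted D (- n) (int_iterate f n x) = matrix_inv (twisted_cocycle f \<alpha> D n x)"
    if D: "\<And>x. invertible (D x)" for D
  proof -
    have "mat 1 = twisted_cocycle f \<alpha> D (- n) (int_iterate f n x)
        ** aut_pow \<alpha> (- n) (twisted_cocycle f \<alpha> D n x)"
      using twisted_cocycle_add[of D n "- n" x, OF D] by (simp add: twisted_cocycle_0[of D, OF D])
    then have "aut_pow \<alpha> n (mat 1) = aut_pow \<alpha> n (twisted_cocycle f \<alpha> D (- n) (int_iterate f n x)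
        ** aut_pow \<alpha> (- n) (twisted_cocycle f \<alpha> D n x))" by simp
    then have "untwisted D (- n) (int_iterate f n x) ** twisted_cocycle f \<alpha> D n x = mat 1"
      by (simp add: untwisted_def aut_simps twisted_cocycle_invertible D)
    then show ?thesis by (rule matrix_inv_unique[symmetric])
  qed
  note this[of A, OF assms(1)] this[of B, OF assms(2)]
  then show ?thesis by (simp add: ratio_def gl_simps assms twisted_cocycle_invertible)
qed

lemma ratio_near_by:
  assumes "\<And>x. invertible (A x)" "\<And>x. invertible (B x)"
    and "opnorm (matrix_inv (untwisted A n x) ** untwisted A n y - mat 1) \<le> exp k - 1"
    and "opnorm (matrix_inv (untwisted B n y) ** untwisted B n x - mat 1) \<le> exp k - 1"
  shows "near_by k (ratio A B n x) (ratio A B n y)"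
proof -
  have "ratio A B n x = (matrix_inv (untwisted A n x) ** untwisted A n y) ** ratio A B n y
      ** (matrix_inv (untwisted B n y) ** untwisted B n x)"
    by (simp add: ratio_def gl_simps untwisted_invertible assms(1,2))
  then show ?thesis using assms(3,4) unfolding near_by_def by blast
qed

end

section \<open>Bracket and closing lemma for hyperbolic homeomorphisms\<close>

locale hyperbolic_homeo =
  fixes f :: "'a::metric_space \<Rightarrow> 'a" and C \<epsilon> l \<tau> :: real
  assumes compact_UNIV: "compact (UNIV :: 'a set)"
    and homeo: "homeomorphism UNIV UNIV f (inv_into UNIV f)"
    and lipschitz: "\<exists>L. L-lipschitz_on UNIV f"
    and hyperbolic: "hyperbolic f C \<epsilon> l \<tau>"
begin

abbreviation it :: "int \<Rightarrow> 'a \<Rightarrow> 'a" where "it \<equiv> int_iterate f"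

lemma bij_f: "bij f"
  using homeo by (auto simp: homeomorphism_def bij_def inj_def) metis+

lemma it_it: "it m (it n x) = it (m + n) x"
  by (simp add: int_iterate_add[OF bij_f])

lemma continuous_on_it: "continuous_on UNIV (it n)"
proof -
  have "continuous_on UNIV (g ^^ k)" if "continuous_on UNIV g" for g :: "'a \<Rightarrow> 'a" and k
    by (induction k) (auto intro: continuous_on_compose2[OF that] simp: id_def)
  then show ?thesis using homeo by (simp add: int_iterate_def homeomorphism_def)
qed

lemma pos: "C > 0" "\<epsilon> > 0" "l > 0" "\<tau> > 0"
  using hyperbolic by (auto simp: hyperbolic_def)

lemma stable_contract:
  assumes "y \<in> stable_set f \<epsilon> x" "z \<in> stable_set f \<epsilon> x" "n \<ge> 0"
  shows "dist (it n y) (it n z) \<le> C * exp (- l * of_int n) * dist y z"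
  using hyperbolic assms unfolding hyperbolic_def by blast

lemma unstable_contract:
  assumes "y \<in> unstable_set f \<epsilon> x" "z \<in> unstable_set f \<epsilon> x" "n \<ge> 0"
  shows "dist (it (- n) y) (it (- n) z) \<le> C * exp (- l * of_int n) * dist y z"
  using hyperbolic assms unfolding hyperbolic_def by blast

lemma self_in_stable: "x \<in> stable_set f \<epsilon> x"
  and self_in_unstable: "x \<in> unstable_set f \<epsilon> x"
  using pos by (auto simp: stable_set_def unstable_set_def)

text \<open>Two points whose full orbits stay \<epsilon>-close both lie in the one-point
  intersection that defines the bracket of \<open>x\<close> with itself.\<close>

lemma expansive:
  assumes "\<And>n. dist (it n x) (it n y) \<le> \<epsilon>"
  shows "x = y"
proof -
  obtain br where "stable_set f \<epsilon> x \<inter> unstable_set f \<epsilon> x = {br (x, x)}"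
    using hyperbolic pos unfolding hyperbolic_def by (metis dist_self less_imp_le)
  moreover have "y \<in> stable_set f \<epsilon> x \<inter> unstable_set f \<epsilon> x"
    using assms by (auto simp: stable_set_def unstable_set_def)
  moreover have "x \<in> stable_set f \<epsilon> x \<inter> unstable_set f \<epsilon> x"
    by (simp add: self_in_stable self_in_unstable)
  ultimately show ?thesis by (metis singletonD)
qed

lemma exp_contraction_small:
  assumes "c > 0"
  obtains N :: nat where "N > 0" "\<And>n. n \<ge> int N \<Longrightarrow> exp (- l * of_int n) \<le> c"
proof -
  obtain N :: nat where N: "of_nat N > (1 + \<bar>ln c\<bar>) / l" using reals_Archimedean2 by blast
  then have lN: "l * real N > 1 + \<bar>ln c\<bar>" using pos by (simp add: field_simps)
  have "N > 0" using lN by (cases N) auto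
  moreover have "exp (- l * of_int n) \<le> c" if "n \<ge> int N" for n
  proof -
    have "l * real N \<le> l * of_int n" using pos that by (intro mult_left_mono) linarith+
    then have "- l * of_int n \<le> ln c" using lN by linarith
    then show ?thesis using assms by (metis exp_le_cancel_iff exp_ln)
  qed
  ultimately show ?thesis using that by blast
qed

lemma lipschitz_iterate:
  obtains L where "L \<ge> 1" "\<And>n x y. dist (it (int n) x) (it (int n) y) \<le> L ^ n * dist x y"
proof -
  obtain L where L: "L-lipschitz_on UNIV f" using lipschitz by blast
  have 1: "dist (f x) (f y) \<le> max L 1 * dist x y" for x y
    using lipschitz_onD[OF L, of x y] by (smt (verit) UNIV_I mult_right_mono zero_le_dist)
  have "dist (it (int n) x) (it (int n) y) \<le> max L 1 ^ n * dist x y" for n x y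
  proof (induction n)
    case (Suc n)
    have "dist (it (int (Suc n)) x) (it (int (Suc n)) y) \<le> max L 1 * dist (it (int n) x) (it (int n) y)"
      using 1 by (simp add: int_iterate_of_nat del: of_nat_Suc)
    also have "\<dots> \<le> max L 1 * (max L 1 ^ n * dist x y)"
      using Suc by (intro mult_left_mono) auto
    finally show ?case by (simp add: mult_ac)
  qed (simp add: int_iterate_0)
  then show ?thesis using that[of "max L 1"] by auto
qed

text \<open>The bracket is only assumed continuous. Forward expansion of the unstable leg, contraction of
  the stable leg and the Lipschitz bound for finitely many iterates force it to be Lipschitz at the
  diagonal.\<close>

lemma bracket_lipschitz:
  obtains K \<delta> where "K \<ge> 1" "\<delta> > 0"
    "\<And>x y. dist x y \<le> \<delta> \<Longrightarrow> \<exists>z. z \<in> stable_set f \<epsilon> x \<and> z \<in> unstable_set f \<epsilon> y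
        \<and> dist x z \<le> K * dist x y \<and> dist y z \<le> K * dist x y"
proof -
  obtain br where br: "\<And>x y. dist x y \<le> \<tau> \<Longrightarrow> stable_set f \<epsilon> x \<inter> unstable_set f \<epsilon> y = {br (x, y)}"
    and br_cont: "continuous_on {(x, y). dist x y \<le> \<tau>} br"
    using hyperbolic unfolding hyperbolic_def by blast
  have "closed {p :: 'a \<times> 'a. dist (fst p) (snd p) \<le> \<tau>}"
    by (intro closed_Collect_le continuous_intros)
  moreover have "{p :: 'a \<times> 'a. dist (fst p) (snd p) \<le> \<tau>} = {(x, y). dist x y \<le> \<tau>}" by auto
  moreover have "compact (UNIV \<times> UNIV :: ('a \<times> 'a) set)"
    by (intro compact_Times compact_UNIV)
  ultimately have "compact {(x :: 'a, y). dist x y \<le> \<tau>}"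
    by (metis UNIV_Times_UNIV compact_Int_closed inf_top_left)
  then have uc: "uniformly_continuous_on {(x, y). dist x y \<le> \<tau>} br"
    using br_cont by (rule compact_uniformly_continuous[rotated])
  have br_diag: "br (x, x) = x" for x
  proof -
    have "x \<in> stable_set f \<epsilon> x \<inter> unstable_set f \<epsilon> x"
      by (simp add: self_in_stable self_in_unstable)
    then have "x \<in> {br (x, x)}" using br[of x x] pos by simp
    then show ?thesis by simp
  qed
  obtain L where L: "L \<ge> 1" "\<And>n x y. dist (it (int n) x) (it (int n) y) \<le> L ^ n * dist x y"
    using lipschitz_iterate by metis
  \<comment> \<open>After \<open>N\<close> steps each leg has contracted by the factor 1/2, with
    \<open>C\<close> absorbed.\<close>
  obtain N :: nat where "N > 0" and N: "\<And>n. n \<ge> int N \<Longrightarrow> exp (- l * of_int n) \<le> 1 / (2 * C)"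
    using exp_contraction_small[of "1 / (2 * C)"] pos by auto
  have CN: "C * exp (- l * of_int (int N)) \<le> 1 / 2"
    using N[of "int N"] pos by (simp add: field_simps)
  \<comment> \<open>\<open>2 * \<eta> * L ^ N = \<epsilon>\<close>: a point within
    \<open>2 * \<eta>\<close> of \<open>y\<close> stays \<epsilon>-close for \<open>N\<close>
    forward steps, so the unstable leg can be contracted backwards from time
    \<open>N\<close>.\<close>
  define \<eta> where "\<eta> = \<epsilon> / (2 * L ^ N)"
  have \<eta>: "\<eta> > 0" using L pos by (simp add: \<eta>_def)
  obtain d where d: "d > 0" "\<And>p q. p \<in> {(x, y). dist x y \<le> \<tau>} \<Longrightarrow> q \<in> {(x, y). dist x y \<le> \<tau>} \<Longrightarrow>
      dist q p < d \<Longrightarrow> dist (br q) (br p) < \<eta>"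
    using uc \<eta> unfolding uniformly_continuous_on_def by metis
  define \<delta> where "\<delta> = Min {\<tau>, d / 2, \<eta>}"
  have \<delta>: "\<delta> > 0" "\<delta> \<le> \<tau>" "\<delta> < d" "\<delta> \<le> \<eta>" using pos d(1) \<eta> by (auto simp: \<delta>_def min_def)
  show ?thesis
  proof (rule that[of "1 + L ^ N" \<delta>])
    fix x y :: 'a
    assume xy: "dist x y \<le> \<delta>"
    define z where "z = br (x, y)"
    have z: "z \<in> stable_set f \<epsilon> x" "z \<in> unstable_set f \<epsilon> y"
      using br[of x y] xy \<delta> by (auto simp: z_def)
    have "dist (br (x, y)) (br (x, x)) < \<eta>"
      by (rule d(2)) (use xy \<delta> pos in \<open>auto simp: dist_Pair_Pair dist_commute\<close>)
    then have zx: "dist z x < \<eta>" by (simp add: z_def br_diag)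
    have zy: "dist z y \<le> 2 * \<eta>"
      using zx xy \<delta> dist_triangle[of z y x] by linarith
    have "dist (it n y) (it n z) \<le> \<epsilon>" if "n \<le> int N" for n
    proof (cases "n \<le> 0")
      case True
      then show ?thesis using z(2) by (auto simp: unstable_set_def)
    next
      case False
      define k where "k = nat n"
      have k: "n = int k" "k \<le> N" using that False by (auto simp: k_def)
      have "dist (it n y) (it n z) \<le> L ^ k * dist y z" unfolding k by (rule L)
      also have "\<dots> \<le> L ^ N * (2 * \<eta>)"
        using L(1) k zy by (intro mult_mono power_increasing) (auto simp: dist_commute)
      also have "\<dots> = \<epsilon>" using L(1) by (simp add: \<eta>_def)
      finally show ?thesis .
    qed
    then have "it (int N) z \<in> unstable_set f \<epsilon> (it (int N) y)"
      by (auto simp: unstable_set_def it_it)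
    from unstable_contract[OF this self_in_unstable, of "int N"]
    have "dist z y \<le> C * exp (- l * of_int (int N)) * dist (it (int N) z) (it (int N) y)"
      by (simp add: it_it int_iterate_0)
    also have "\<dots> \<le> 1 / 2 * dist (it (int N) z) (it (int N) y)"
      by (rule mult_right_mono[OF CN]) simp
    also have "dist (it (int N) z) (it (int N) y)
        \<le> dist (it (int N) z) (it (int N) x) + dist (it (int N) x) (it (int N) y)"
      by (rule dist_triangle)
    also have "dist (it (int N) z) (it (int N) x) \<le> 1 / 2 * dist z x"
      using stable_contract[OF z(1) self_in_stable, of "int N"] mult_right_mono[OF CN, of "dist z x"]
      by simp
    also have "dist (it (int N) x) (it (int N) y) \<le> L ^ N * dist x y" by (rule L)
    \<comment> \<open>Inserting \<open>dist z x \<le> dist x y + dist z y\<close> lets the quarter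
      be absorbed on the left; as \<open>L ^ N \<ge> 1\<close>, what remains is at most
      \<open>L ^ N * dist x y\<close>.\<close>
    finally have 1: "dist z y \<le> 1 / 4 * dist z x + 1 / 2 * (L ^ N * dist x y)" by simp
    have "dist x y \<le> L ^ N * dist x y" using L(1) by (simp add: mult_le_cancel_right1)
    then have "dist z y \<le> L ^ N * dist x y" "dist z x \<le> dist x y + L ^ N * dist x y"
      using 1 dist_triangle[of z x y] dist_commute[of x y] by linarith+
    then show "\<exists>z. z \<in> stable_set f \<epsilon> x \<and> z \<in> unstable_set f \<epsilon> y
        \<and> dist x z \<le> (1 + L ^ N) * dist x y \<and> dist y z \<le> (1 + L ^ N) * dist x y"
      using z by (intro exI[of _ z]) (auto simp: algebra_simps dist_commute intro: order_trans)
  qed (use \<delta> L in auto)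
qed

text \<open>Anosov closing: repeatedly bracket \<open>x\<close> with the \<open>n\<close>-th image of the current point, pull back to
  centre the resulting orbit segments, and take a limit; expansivity makes it periodic.\<close>

lemma closing:
  obtains K \<delta> and n0 :: nat where "K > 0" "\<delta> > 0"
    "\<And>x n. n \<ge> int n0 \<Longrightarrow> dist x (it n x) \<le> \<delta> \<Longrightarrow>
       \<exists>q. it n q = q \<and> (\<forall>i. 0 \<le> i \<longrightarrow> i \<le> n \<longrightarrow> dist (it i x) (it i q) \<le> K * dist x (it n x))"
proof -
  obtain K \<delta>0 where K: "K \<ge> 1" "\<delta>0 > 0" and bracket:
    "\<And>x y. dist x y \<le> \<delta>0 \<Longrightarrow> \<exists>z. z \<in> stable_set f \<epsilon> x \<and> z \<in> unstable_set f \<epsilon> y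
        \<and> dist x z \<le> K * dist x y \<and> dist y z \<le> K * dist x y"
    by (rule bracket_lipschitz) blast
  \<comment> \<open>The bound 1/2 drives the geometric series of pull-backs. The other one keeps the
    iteration going: a point of the stable set within \<open>2 * K * \<delta>\<close> of
    \<open>x\<close> has its \<open>n\<close>-th image within \<delta> of that of
    \<open>x\<close>.\<close>
  obtain n0 :: nat where n0: "n0 > 0"
    "\<And>n. n \<ge> int n0 \<Longrightarrow> exp (- l * of_int n) \<le> min (1 / 2) (1 / (2 * K * C))"
    using exp_contraction_small[of "min (1 / 2) (1 / (2 * K * C))"] K pos by auto
  \<comment> \<open>The pull-backs cost \<open>4 * K * C\<close>, the sum of a series with first
    term \<open>2 * K * C\<close> and ratio 1/2; the stable leg from \<open>x\<close> adds
    \<open>2 * K * C\<close>.\<close>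
  define K2 where "K2 = 6 * K * C"
  have K2: "K2 > 0" using K pos by (simp add: K2_def)
  \<comment> \<open>The bracket is taken at distance up to twice the gap, hence
    \<open>\<delta>0 / 2\<close>; the second bound keeps twice the shadowing error within
    \<epsilon>, as expansivity demands.\<close>
  define \<delta>1 where "\<delta>1 = min (\<delta>0 / 2) (\<epsilon> / (2 * K2))"
  have \<delta>1: "\<delta>1 > 0" using K K2 pos by (simp add: \<delta>1_def)
  show ?thesis
  proof (rule that[of K2 \<delta>1 n0])
    fix x and n :: int
    assume n: "n \<ge> int n0" and close: "dist x (it n x) \<le> \<delta>1"
    define \<delta> where "\<delta> = dist x (it n x)"
    have \<delta>: "\<delta> \<ge> 0" "2 * \<delta> \<le> \<delta>0" using close by (simp_all add: \<delta>_def \<delta>1_def)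
    have "K2 * \<delta> \<le> K2 * (\<epsilon> / (2 * K2))"
      using close K2 by (intro mult_left_mono) (auto simp: \<delta>_def \<delta>1_def)
    then have K2\<delta>: "2 * (K2 * \<delta>) \<le> \<epsilon>" using K2 by simp
    have exp_n: "exp (- l * of_int n) \<le> 1 / 2" "C * exp (- l * of_int n) * (2 * K) \<le> 1"
      using n0(2)[OF n] K pos by (simp_all add: field_simps)
    have npos: "n > 0" using n n0(1) by linarith
    define P where "P = (\<lambda>(k::nat) y. y \<in> stable_set f \<epsilon> x \<and> dist x y \<le> 2 * K * \<delta>)"
    define Q where "Q = (\<lambda>(k::nat) y z. z \<in> unstable_set f \<epsilon> (it n y) \<and> dist (it n y) z \<le> 2 * K * \<delta>)"
    have "\<exists>y. \<forall>k. P k (y k) \<and> Q k (y k) (y (Suc k))"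
    proof (rule dependent_nat_choice)
      show "\<exists>y. P 0 y" using self_in_stable \<delta> K by (auto simp: P_def intro!: exI[of _ x])
    next
      fix y k assume "P k y"
      then have y: "y \<in> stable_set f \<epsilon> x" "dist x y \<le> 2 * K * \<delta>" by (auto simp: P_def)
      have "dist (it n x) (it n y) \<le> C * exp (- l * of_int n) * dist x y"
        by (rule stable_contract[OF self_in_stable y(1)]) (use npos in simp)
      also have "\<dots> \<le> C * exp (- l * of_int n) * (2 * K * \<delta>)"
        using y(2) pos by (intro mult_left_mono) auto
      also have "\<dots> \<le> \<delta>" using mult_right_mono[OF exp_n(2) \<delta>(1)] by (simp add: mult_ac)
      finally have *: "dist x (it n y) \<le> 2 * \<delta>"
        using dist_triangle[of x "it n y" "it n x"] by (simp add: \<delta>_def)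
      then obtain z where "z \<in> stable_set f \<epsilon> x" "z \<in> unstable_set f \<epsilon> (it n y)"
        and z: "dist x z \<le> K * dist x (it n y)" "dist (it n y) z \<le> K * dist x (it n y)"
        using bracket[of x "it n y"] \<delta> by auto
      moreover have "K * dist x (it n y) \<le> 2 * K * \<delta>" using mult_left_mono[OF *, of K] K by simp
      ultimately show "\<exists>z. P (Suc k) z \<and> Q k y z" unfolding P_def Q_def by (meson order_trans)
    qed
    then obtain y where y: "\<And>k. y k \<in> stable_set f \<epsilon> x" "\<And>k. dist x (y k) \<le> 2 * K * \<delta>"
      "\<And>k. y (Suc k) \<in> unstable_set f \<epsilon> (it n (y k))" "\<And>k. dist (it n (y k)) (y (Suc k)) \<le> 2 * K * \<delta>"
      unfolding P_def Q_def by auto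
    \<comment> \<open>Pulled back by \<open>n\<close>, \<open>y (Suc k)\<close> lies near
      \<open>y k\<close>, and each further block of length \<open>n\<close> halves the error. With
      \<open>i \<le> n\<close>, the \<open>t\<close>-th correction has passed at least
      \<open>t\<close> whole blocks.\<close>
    have pull: "dist (it (i - int t * n) (y (j + t))) (it i (y j)) \<le> 4 * K * C * \<delta> * (1 - (1 / 2) ^ t)"
      if "i \<le> n" for i j t
    proof (induction t)
      case 0
      then show ?case by simp
    next
      case (Suc t)
      define s where "s = int (Suc t) * n - i"
      have s: "s \<ge> int t * n" using that npos by (simp add: s_def algebra_simps)
      then have "s \<ge> 0" using npos by (smt (verit) mult_nonneg_nonneg of_nat_0_le_iff)
      have "of_int (int t * n) \<le> (of_int s :: real)" using s by (simp only: of_int_le_iff)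
      then have "- l * of_int s \<le> real t * (- l * of_int n)"
        using mult_left_mono[of "of_int (int t * n)" "of_int s" l] pos
        by (simp add: algebra_simps)
      then have "exp (- l * of_int s) \<le> exp (- l * of_int n) ^ t"
        unfolding exp_of_nat_mult[symmetric] by simp
      also have "\<dots> \<le> (1 / 2) ^ t" by (rule power_mono[OF exp_n(1)]) simp
      finally have es: "exp (- l * of_int s) \<le> (1 / 2) ^ t" .
      have "dist (it (- s) (y (Suc (j + t)))) (it (- s) (it n (y (j + t))))
          \<le> C * exp (- l * of_int s) * dist (y (Suc (j + t))) (it n (y (j + t)))"
        by (rule unstable_contract[OF y(3) self_in_unstable \<open>s \<ge> 0\<close>])
      also have "\<dots> \<le> C * (1 / 2) ^ t * (2 * K * \<delta>)"
        using es y(4) pos by (intro mult_mono) (auto simp: dist_commute)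
      also have "it (- s) (it n (y (j + t))) = it (i - int t * n) (y (j + t))"
        by (simp add: it_it s_def algebra_simps)
      finally have "dist (it (- s) (y (Suc (j + t)))) (it i (y j))
          \<le> C * (1 / 2) ^ t * (2 * K * \<delta>) + 4 * K * C * \<delta> * (1 - (1 / 2) ^ t)"
        using Suc dist_triangle[of "it (- s) (y (Suc (j + t)))" "it i (y j)" "it (i - int t * n) (y (j + t))"]
        by linarith
      then show ?case by (simp add: s_def algebra_simps)
    qed
    \<comment> \<open>The index \<open>2 * j\<close> centres the orbit: its block \<open>s\<close>
      is traced by \<open>y (j + s)\<close>, from which \<open>y (2 * j)\<close> is
      \<open>j - s\<close> blocks ahead; both counts are nonnegative when
      \<open>\<bar>s\<bar> \<le> j\<close>.\<close>
    have shadow: "dist (it (s * n + i) (it (- int j * n) (y (2 * j)))) (it i x) \<le> K2 * \<delta>"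
      if i: "0 \<le> i" "i \<le> n" and j: "\<bar>s\<bar> \<le> int j" for i s j
    proof -
      define t u where "t = nat (int j - s)" and "u = nat (int j + s)"
      have tu: "u + t = 2 * j" "int t = int j - s" using j by (auto simp: t_def u_def)
      have "it (s * n + i) (it (- int j * n) (y (2 * j))) = it (i - int t * n) (y (u + t))"
        unfolding tu(1) it_it tu(2) by (simp add: algebra_simps)
      moreover have "dist (it (i - int t * n) (y (u + t))) (it i (y u)) \<le> 4 * K * C * \<delta>"
      proof -
        have "4 * K * C * \<delta> * (1 - (1 / 2) ^ t) \<le> 4 * K * C * \<delta>"
          using K pos \<delta> by (intro mult_left_le) (auto simp: power_le_one)
        then show ?thesis using pull[OF i(2), of t u] by linarith
      qed
      moreover have "dist (it i (y u)) (it i x) \<le> 2 * K * C * \<delta>"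
      proof -
        have "dist (it i (y u)) (it i x) \<le> C * exp (- l * of_int i) * dist (y u) x"
          by (rule stable_contract[OF y(1) self_in_stable i(1)])
        also have "\<dots> \<le> C * 1 * (2 * K * \<delta>)"
          using y(2)[of u] pos i by (intro mult_mono) (auto simp: dist_commute)
        finally show ?thesis by (simp add: mult_ac)
      qed
      ultimately show ?thesis
        using dist_triangle[of "it (i - int t * n) (y (u + t))" "it i x" "it i (y u)"]
        by (simp add: K2_def algebra_simps)
    qed
    define q where "q = (\<lambda>j. it (- int j * n) (y (2 * j)))"
    obtain q' r where r: "strict_mono r" "(q \<circ> r) \<longlonglongrightarrow> q'"
      using compact_UNIV unfolding compact_def by blast
    have lim: "dist (it (s * n + i) q') (it i x) \<le> K2 * \<delta>" if i: "0 \<le> i" "i \<le> n" for s i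
    proof -
      have "(\<lambda>j. it (s * n + i) ((q \<circ> r) j)) \<longlonglongrightarrow> it (s * n + i) q'"
        using continuous_on_tendsto_compose[OF continuous_on_it r(2)] by simp
      then have "(\<lambda>j. dist (it (s * n + i) ((q \<circ> r) j)) (it i x)) \<longlonglongrightarrow> dist (it (s * n + i) q') (it i x)"
        by (intro tendsto_intros)
      moreover have "\<forall>\<^sub>F j in sequentially. dist (it (s * n + i) ((q \<circ> r) j)) (it i x) \<le> K2 * \<delta>"
        using eventually_ge_at_top[of "nat \<bar>s\<bar>"]
      proof eventually_elim
        case (elim j)
        then have "\<bar>s\<bar> \<le> int (r j)" using seq_suble[OF r(1), of j] by linarith
        from shadow[OF i this] show ?case by (simp add: q_def)
      qed
      ultimately show ?thesis by (intro tendsto_upperbound) auto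
    qed
    \<comment> \<open>At every time \<open>N\<close>, the orbit of \<open>q'\<close> and its shift
      by \<open>n\<close> shadow the same point of the segment of \<open>x\<close>, the one at time
      \<open>N mod n\<close>.\<close>
    have "q' = it n q'"
    proof (rule expansive)
      fix N
      have i: "0 \<le> N mod n" "N mod n \<le> n" using npos by (auto intro: less_imp_le)
      have "(N div n + 1) * n + N mod n = N + n" by (simp add: algebra_simps)
      then have "dist (it (N + n) q') (it (N mod n) x) \<le> K2 * \<delta>"
        using lim[OF i, of "N div n + 1"] by simp
      moreover have "dist (it N q') (it (N mod n) x) \<le> K2 * \<delta>"
        using lim[OF i, of "N div n"] by simp
      ultimately have "dist (it N q') (it (N + n) q') \<le> \<epsilon>"
        using dist_triangle2[of "it N q'" "it (N + n) q'" "it (N mod n) x"] K2\<delta> by linarith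
      then show "dist (it N q') (it N (it n q')) \<le> \<epsilon>" by (simp add: it_it)
    qed
    moreover have "dist (it i x) (it i q') \<le> K2 * dist x (it n x)" if "0 \<le> i" "i \<le> n" for i
      using lim[OF that, of 0] by (simp add: \<delta>_def dist_commute)
    ultimately show "\<exists>q. it n q = q \<and>
        (\<forall>i. 0 \<le> i \<longrightarrow> i \<le> n \<longrightarrow> dist (it i x) (it i q) \<le> K2 * dist x (it n x))"
      by metis
  qed (use K2 \<delta>1 in auto)
qed

end

section \<open>Distortion along nearby orbits\<close>

lemma continuous_on_matrix_vector_mult:
  fixes A :: "'a::topological_space \<Rightarrow> real^'n^'m"
  assumes "continuous_on S A" "continuous_on S v"
  shows "continuous_on S (\<lambda>x. A x *v v x)"
  unfolding matrix_vector_mult_def using assms by (intro continuous_intros)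

text \<open>Compactness gives \<open>norm (A x *v v)\<close> a positive minimum \<open>m\<close>
  over \<open>S\<close> and the unit sphere, and \<open>1 / m\<close> bounds the inverses, without
  an appeal to continuity of inversion.\<close>

lemma opnorm_matrix_inv_bounded:
  fixes A :: "'a::topological_space \<Rightarrow> real^'d^'d"
  assumes "compact S" "continuous_on S A" "\<And>x. x \<in> S \<Longrightarrow> invertible (A x)"
  shows "\<exists>M. \<forall>x\<in>S. opnorm (matrix_inv (A x)) \<le> M"
proof (cases "S = {}")
  case False
  define K where "K = S \<times> sphere (0 :: real^'d) 1"
  have K1: "compact K" unfolding K_def by (intro compact_Times assms compact_sphere)
  have K2: "K \<noteq> {}" using False vector_choose_size[of 1] by (auto simp: K_def)
  have K3: "continuous_on K (\<lambda>p. norm (A (fst p) *v snd p))"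
    by (intro continuous_on_norm continuous_on_matrix_vector_mult
        continuous_on_compose2[OF assms(2)] continuous_intros) (auto simp: K_def)
  obtain p where p: "p \<in> K"
    "\<And>q. q \<in> K \<Longrightarrow> norm (A (fst p) *v snd p) \<le> norm (A (fst q) *v snd q)"
    using continuous_attains_inf[OF K1 K2 K3] by blast
  define m where "m = norm (A (fst p) *v snd p)"
  have "A (fst p) *v snd p \<noteq> 0"
  proof
    assume "A (fst p) *v snd p = 0"
    then have "matrix_inv (A (fst p)) *v (A (fst p) *v snd p) = 0" by simp
    then have "snd p = 0"
      using p(1) assms(3) by (simp add: matrix_vector_mul_assoc matrix_inv K_def mem_Times_iff)
    then show False using p(1) by (simp add: K_def mem_Times_iff)
  qed
  then have m: "m > 0" by (simp add: m_def)
  have lower: "m * norm v \<le> norm (A x *v v)" if "x \<in> S" for x v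
  proof (cases "v = 0")
    case False
    have "m \<le> norm (A x *v (v /\<^sub>R norm v))"
      using p(2)[of "(x, v /\<^sub>R norm v)"] that False by (simp add: m_def K_def)
    then show ?thesis
      using False by (simp add: matrix_vector_mult_scaleR field_simps)
  qed simp
  have "opnorm (matrix_inv (A x)) \<le> 1 / m" if x: "x \<in> S" for x
  proof (rule onorm_le)
    fix w
    show "norm (matrix_inv (A x) *v w) \<le> 1 / m * norm w"
      using lower[OF x, of "matrix_inv (A x) *v w"] m assms(3)[OF x]
      by (simp add: matrix_vector_mul_assoc matrix_inv field_simps)
  qed
  then show ?thesis by blast
qed simp

lemma sum_exp_le:
  assumes "\<sigma> > 0"
  shows "(\<Sum>i<n. exp (\<sigma> * real i)) \<le> exp (\<sigma> * real n) / (exp \<sigma> - 1)"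
proof -
  have "(\<Sum>i<n. exp (\<sigma> * real i)) = (\<Sum>i<n. exp \<sigma> ^ i)"
    by (simp add: exp_of_nat2_mult)
  also have "\<dots> = (exp \<sigma> ^ n - 1) / (exp \<sigma> - 1)"
    using assms by (intro geometric_sum) simp
  also have "\<dots> \<le> exp \<sigma> ^ n / (exp \<sigma> - 1)"
    using assms by (intro divide_right_mono) auto
  finally show ?thesis by (simp add: exp_of_nat2_mult)
qed

text \<open>The bound is independent of \<open>n\<close>, which is what makes comparisons along
  stable and unstable legs uniform in time.\<close>

lemma sum_exp_neg_le:
  assumes "\<sigma> < 0"
  shows "(\<Sum>i<n. exp (\<sigma> * real i)) \<le> 1 / (1 - exp \<sigma>)"
proof -
  have "(\<Sum>i<n. exp (\<sigma> * real i)) = (\<Sum>i<n. exp \<sigma> ^ i)"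
    by (simp add: exp_of_nat2_mult)
  also have "\<dots> \<le> (\<Sum>i. exp \<sigma> ^ i)"
    using assms by (intro sum_le_suminf summable_geometric) auto
  also have "\<dots> = 1 / (1 - exp \<sigma>)" using assms by (intro suminf_geometric) simp
  finally show ?thesis .
qed

locale twisted_hyperbolic = hyperbolic_homeo f C \<epsilon> l \<tau>
  for f :: "'a::metric_space \<Rightarrow> 'a" and C \<epsilon> l \<tau> +
  fixes \<alpha> :: "real^'d^'d \<Rightarrow> real^'d^'d"
  assumes aut: "\<alpha> \<in> carrier (AutoGroup GL)"

sublocale twisted_hyperbolic \<subseteq> twisting f \<alpha>
  by unfold_locales (rule bij_f, rule aut)

context twisted_hyperbolic
begin

text \<open>The amplification rate is \<open>\<theta> + 2\<rho>\<close>: fiber-bunching bounds the condition number of the partial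
  products by \<open>e\<^sup>\<theta>\<^sup>i\<close> and each of the two twisted one-step factors by \<open>e\<^sup>\<rho>\<^sup>i\<close>.\<close>

lemma untwisted_distortion:
  assumes A: "holder_GL \<nu> A" and bunched: "fiber_bunched f l \<nu> \<alpha> A"
  obtains c0 \<sigma>0 where "c0 > 0" "0 < \<sigma>0" "\<sigma>0 < \<nu> * l" "\<nu> > 0"
    "\<And>c \<sigma> x y n \<Delta>. \<lbrakk>c \<ge> c0; \<sigma> \<ge> \<sigma>0; \<And>i. i < n \<Longrightarrow> dist (it (int i) x) (it (int i) y) \<le> \<Delta> i\<rbrakk> \<Longrightarrow>
      opnorm (matrix_inv (untwisted A (int n) y) ** untwisted A (int n) x - mat 1)
        \<le> exp (c * (\<Sum>i<n. exp (\<sigma> * real i) * \<Delta> i powr \<nu>)) - 1"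
    "\<And>c \<sigma> x y n \<Delta>. \<lbrakk>c \<ge> c0; \<sigma> \<ge> \<sigma>0; \<And>i. i < n \<Longrightarrow> dist (it (- int i - 1) x) (it (- int i - 1) y) \<le> \<Delta> i\<rbrakk> \<Longrightarrow>
      opnorm (matrix_inv (untwisted A (- int n) y) ** untwisted A (- int n) x - mat 1)
        \<le> exp (c * (\<Sum>i<n. exp (\<sigma> * real i) * \<Delta> i powr \<nu>)) - 1"
proof -
  have inv: "invertible (A x)" for x using A by (simp add: holder_GL_def carrier_GL)
  obtain H where H: "H > 0" "\<And>x y. opnorm (A x - A y) \<le> H * dist x y powr \<nu>"
    using A by (auto simp: holder_GL_def)
  obtain D \<rho> \<theta> where D: "D > 0" "\<rho> > 0" "\<theta> > 0" "5 * \<rho> + 2 * \<theta> < \<nu> * l"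
    and D_all: "\<forall>n::int.
         (\<forall>x. opnorm (aut_pow \<alpha> (- n) (twisted_cocycle f \<alpha> A n x)) *
              opnorm (aut_pow \<alpha> (- n) (matrix_inv (twisted_cocycle f \<alpha> A n x)))
              < D * exp (\<theta> * of_int \<bar>n\<bar>)) \<and>
         (\<forall>T1\<in>carrier GL. \<forall>T2\<in>carrier GL.
            opnorm (aut_pow \<alpha> n T1 - aut_pow \<alpha> n T2) \<le> D * exp (\<rho> * of_int \<bar>n\<bar>) * opnorm (T1 - T2)) \<and>
         (\<forall>T\<in>carrier GL. opnorm (aut_pow \<alpha> n T) \<le> D * exp (\<rho> * of_int \<bar>n\<bar>) * opnorm T)"
    using bunched unfolding fiber_bunched_def by (elim exE conjE) (rule that)
  have D1: "opnorm (aut_pow \<alpha> (- n) (twisted_cocycle f \<alpha> A n x)) *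
      opnorm (aut_pow \<alpha> (- n) (matrix_inv (twisted_cocycle f \<alpha> A n x))) < D * exp (\<theta> * of_int \<bar>n\<bar>)" for n x
    using spec[OF D_all, of n] by simp
  have D2: "opnorm (aut_pow \<alpha> n S - aut_pow \<alpha> n T) \<le> D * exp (\<rho> * of_int \<bar>n\<bar>) * opnorm (S - T)"
    if "invertible S" "invertible T" for n S T
    using spec[OF D_all, of n] that by (simp add: carrier_GL)
  have D3: "opnorm (aut_pow \<alpha> n T) \<le> D * exp (\<rho> * of_int \<bar>n\<bar>) * opnorm T" if "invertible T" for n T
    using spec[OF D_all, of n] that by (simp add: carrier_GL)
  have nu: "\<nu> > 0" using D pos(3) by (smt (verit) mult_nonneg_nonneg mult_minus_left)
  have cont: "continuous_on UNIV A" by (rule continuous_on_opnorm_modulus[OF H(2) nu])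
  obtain M1 where M1: "\<And>x. opnorm (matrix_inv (A x)) \<le> M1"
    using opnorm_matrix_inv_bounded[OF compact_UNIV cont] inv by auto
  have "bounded (range (\<lambda>x. opnorm (A x)))"
    by (intro compact_imp_bounded compact_continuous_image continuous_on_opnorm cont compact_UNIV)
  then obtain M2 where M2: "\<And>x. opnorm (A x) \<le> M2"
    unfolding bounded_iff by (metis UNIV_I image_eqI abs_le_D1 real_norm_def)
  define M where "M = max 1 (max M1 M2)"
  have M: "M \<ge> 1" "\<And>x. opnorm (matrix_inv (A x)) \<le> M" "\<And>x. opnorm (A x) \<le> M"
    using M1 M2 by (auto simp: M_def le_max_iff_disj)
  have inv_diff: "opnorm (matrix_inv (A x) - matrix_inv (A y)) \<le> M * M * (H * dist x y powr \<nu>)" for x y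
  proof -
    have "matrix_inv (A x) - matrix_inv (A y) = matrix_inv (A x) ** (A y - A x) ** matrix_inv (A y)"
      by (simp add: matrix_diff_distrib gl_simps inv)
    also have "opnorm \<dots> \<le> opnorm (matrix_inv (A x)) * opnorm (A y - A x) * opnorm (matrix_inv (A y))"
      by (meson opnorm_mult opnorm_nonneg mult_right_mono order_trans)
    also have "\<dots> \<le> M * (H * dist x y powr \<nu>) * M"
      using M H(2)[of x y] by (intro mult_mono) (auto simp: opnorm_nonneg opnorm_minus_commute H(1) less_imp_le)
    finally show ?thesis by (simp add: mult_ac)
  qed
  have cond: "opnorm (untwisted A n y) * opnorm (matrix_inv (untwisted A n y))
      \<le> D * exp (\<theta> * of_int \<bar>n\<bar>)" for n y
    using D1[of n y] by (simp add: untwisted_def aut_pow_inv twisted_cocycle_invertible[of A, OF inv] less_imp_le)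
  \<comment> \<open>These constants serve both time directions. Forward factors carry the exponent
    \<open>-(i + 1)\<close>, whence \<open>exp \<rho>\<close>; backward factors are inverses of
    values of \<open>A\<close>, whose differences cost \<open>M * M * H\<close>. The opposite
    direction is padded using \<open>exp \<rho> \<ge> 1\<close> and
    \<open>M \<ge> 1\<close>.\<close>
  define a where "a = D * exp \<rho> * M"
  define b where "b = D * exp \<rho> * (M * M * H)"
  define c0 where "c0 = D * a * b"
  define \<sigma>0 where "\<sigma>0 = \<theta> + 2 * \<rho>"
  have ab: "a > 0" "b > 0" using D M H by (simp_all add: a_def b_def)
  have c0: "c0 > 0" using D ab by (simp add: c0_def)
  have bound: "opnorm (matrix_inv (d n) ** e n - mat 1)
        \<le> exp (c * (\<Sum>i<n. exp (\<sigma> * real i) * \<Delta> i powr \<nu>)) - 1"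
    if c: "c \<ge> c0" and \<sigma>: "\<sigma> \<ge> \<sigma>0"
      and 0: "e 0 = mat 1" "d 0 = mat 1"
      and e: "\<And>i. i < n \<Longrightarrow> e (Suc i) = g i ** e i"
      and d: "\<And>i. i < n \<Longrightarrow> d (Suc i) = k i ** d i"
      and invd: "\<And>i. invertible (d i)" "\<And>i. invertible (k i)"
      and condd: "\<And>i. opnorm (d i) * opnorm (matrix_inv (d i)) \<le> D * exp (\<theta> * real i)"
      and k: "\<And>i. opnorm (matrix_inv (k i)) \<le> a * exp (\<rho> * real i)"
      and gk: "\<And>i. i < n \<Longrightarrow> opnorm (g i - k i) \<le> b * exp (\<rho> * real i) * \<Delta> i powr \<nu>"
    for c \<sigma> n \<Delta> and d e g k :: "nat \<Rightarrow> real^'d^'d"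
  proof -
    have "opnorm (matrix_inv (d n) ** e n - mat 1)
        \<le> exp (\<Sum>i<n. c * (exp (\<sigma> * real i) * \<Delta> i powr \<nu>)) - 1"
    proof (rule opnorm_product_quotient[OF 0 e d invd])
      fix i assume i: "i < n"
      have "opnorm (d i) * opnorm (matrix_inv (d i)) * (opnorm (matrix_inv (k i)) * opnorm (g i - k i))
        \<le> D * exp (\<theta> * real i) * (a * exp (\<rho> * real i) * (b * exp (\<rho> * real i) * \<Delta> i powr \<nu>))"
        using D(1) ab
        by (intro mult_mono[OF condd mult_mono[OF k gk[OF i]]])
          (simp_all add: opnorm_nonneg less_imp_le)
      also have "\<dots> = c0 * (exp (\<sigma>0 * real i) * \<Delta> i powr \<nu>)"
      proof -
        have "exp (\<sigma>0 * real i) = exp (\<theta> * real i) * exp (\<rho> * real i) * exp (\<rho> * real i)"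
          unfolding exp_add[symmetric] by (simp add: \<sigma>0_def algebra_simps)
        then show ?thesis by (simp add: c0_def mult_ac)
      qed
      also have "\<dots> \<le> c * (exp (\<sigma> * real i) * \<Delta> i powr \<nu>)"
        using c \<sigma> c0 by (intro mult_mono) (auto intro: mult_right_mono)
      finally show "opnorm (d i) * opnorm (matrix_inv (d i)) * (opnorm (matrix_inv (k i)) * opnorm (g i - k i))
        \<le> c * (exp (\<sigma> * real i) * \<Delta> i powr \<nu>)" .
    qed auto
    then show ?thesis by (simp add: sum_distrib_left)
  qed
  have mono\<Delta>: "u powr \<nu> \<le> v powr \<nu>" if "0 \<le> u" "u \<le> v" for u v :: real
    using that nu by (intro powr_mono2) auto
  have exp_Suc: "exp (\<rho> * of_int \<bar>- (int i + 1)\<bar>) = exp \<rho> * exp (\<rho> * real i)" for i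
  proof -
    have "of_int \<bar>- (int i + 1)\<bar> = (1 + real i)" by simp
    then show ?thesis unfolding exp_add[symmetric] by (simp add: algebra_simps)
  qed
  show ?thesis
  proof (rule that[of c0 \<sigma>0])
    show "0 < \<sigma>0" "\<sigma>0 < \<nu> * l" using D by (simp_all add: \<sigma>0_def)
  next
    fix c \<sigma> x y n \<Delta>
    assume c: "c \<ge> c0" "\<sigma> \<ge> \<sigma>0"
      and \<Delta>: "\<And>i. i < n \<Longrightarrow> dist (it (int i) x) (it (int i) y) \<le> \<Delta> i"
    have step: "untwisted A (int (Suc i)) z
      = aut_pow \<alpha> (- (int i + 1)) (A (it (int i) z)) ** untwisted A (int i) z" for i z
    proof -
      have "int (Suc i) = int i + 1" by simp
      then show ?thesis using untwisted_Suc[of A "int i" z, OF inv] by (simp only:)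
    qed
    show "opnorm (matrix_inv (untwisted A (int n) y) ** untwisted A (int n) x - mat 1)
        \<le> exp (c * (\<Sum>i<n. exp (\<sigma> * real i) * \<Delta> i powr \<nu>)) - 1"
    proof (rule bound[OF c, where e="\<lambda>i. untwisted A (int i) x" and d="\<lambda>i. untwisted A (int i) y"
          and g="\<lambda>i. aut_pow \<alpha> (- (int i + 1)) (A (it (int i) x))"
          and k="\<lambda>i. aut_pow \<alpha> (- (int i + 1)) (A (it (int i) y))"])
      fix i
      show "opnorm (matrix_inv (aut_pow \<alpha> (- (int i + 1)) (A (it (int i) y)))) \<le> a * exp (\<rho> * real i)"
      proof -
        have "opnorm (aut_pow \<alpha> (- (int i + 1)) (matrix_inv (A (it (int i) y))))
          \<le> D * exp (\<rho> * of_int \<bar>- (int i + 1)\<bar>) * opnorm (matrix_inv (A (it (int i) y)))"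
          by (rule D3) (simp add: inv gl_simps)
        also have "\<dots> \<le> D * exp (\<rho> * of_int \<bar>- (int i + 1)\<bar>) * M"
          using D M by (intro mult_left_mono) auto
        finally show ?thesis unfolding exp_Suc by (simp add: aut_pow_inv inv a_def mult_ac)
      qed
      show "opnorm (aut_pow \<alpha> (- (int i + 1)) (A (it (int i) x)) - aut_pow \<alpha> (- (int i + 1)) (A (it (int i) y)))
          \<le> b * exp (\<rho> * real i) * \<Delta> i powr \<nu>" if i: "i < n"
      proof -
        have "opnorm (aut_pow \<alpha> (- (int i + 1)) (A (it (int i) x)) - aut_pow \<alpha> (- (int i + 1)) (A (it (int i) y)))
          \<le> D * exp (\<rho> * of_int \<bar>- (int i + 1)\<bar>) * opnorm (A (it (int i) x) - A (it (int i) y))"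
          by (rule D2) (simp_all add: inv)
        also have "\<dots> \<le> D * exp (\<rho> * of_int \<bar>- (int i + 1)\<bar>) * (1 * 1 * H * \<Delta> i powr \<nu>)"
        proof (rule mult_left_mono)
          show "opnorm (A (it (int i) x) - A (it (int i) y)) \<le> 1 * 1 * H * \<Delta> i powr \<nu>"
            using order_trans[OF H(2)[of "it (int i) x" "it (int i) y"]
                mult_left_mono[OF mono\<Delta>[OF zero_le_dist \<Delta>[OF i]] less_imp_le[OF H(1)]]]
            by simp
        qed (use D in simp)
        also have "\<dots> \<le> D * exp (\<rho> * of_int \<bar>- (int i + 1)\<bar>) * (M * M * H * \<Delta> i powr \<nu>)"
          using D M H mult_mono[of 1 M 1 M] by (intro mult_left_mono mult_right_mono) auto
        finally show ?thesis unfolding exp_Suc by (simp add: b_def mult_ac)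
      qed
      show "opnorm (untwisted A (int i) y) * opnorm (matrix_inv (untwisted A (int i) y)) \<le> D * exp (\<theta> * real i)"
        using cond[of "int i" y] by simp
      show "untwisted A (int (Suc i)) x = aut_pow \<alpha> (- (int i + 1)) (A (it (int i) x)) ** untwisted A (int i) x"
        "untwisted A (int (Suc i)) y = aut_pow \<alpha> (- (int i + 1)) (A (it (int i) y)) ** untwisted A (int i) y"
        by (rule step)+
      show "invertible (untwisted A (int i) y)" by (rule untwisted_invertible[of A, OF inv])
      show "invertible (aut_pow \<alpha> (- (int i + 1)) (A (it (int i) y)))" by (rule aut_pow_invertible[OF inv])
    qed (simp_all add: untwisted_0)
  next
    fix c \<sigma> x y n \<Delta>
    assume c: "c \<ge> c0" "\<sigma> \<ge> \<sigma>0"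
      and \<Delta>: "\<And>i. i < n \<Longrightarrow> dist (it (- int i - 1) x) (it (- int i - 1) y) \<le> \<Delta> i"
    have step: "untwisted A (- int (Suc i)) z
      = aut_pow \<alpha> (int i) (matrix_inv (A (it (- int i - 1) z))) ** untwisted A (- int i) z" for i z
    proof -
      have "- int (Suc i) = - int i - 1" by simp
      then show ?thesis using untwisted_pred[of A "- int i" z, OF inv] by (simp only: minus_minus)
    qed
    show "opnorm (matrix_inv (untwisted A (- int n) y) ** untwisted A (- int n) x - mat 1)
        \<le> exp (c * (\<Sum>i<n. exp (\<sigma> * real i) * \<Delta> i powr \<nu>)) - 1"
    proof (rule bound[OF c, where e="\<lambda>i. untwisted A (- int i) x" and d="\<lambda>i. untwisted A (- int i) y"
          and g="\<lambda>i. aut_pow \<alpha> (int i) (matrix_inv (A (it (- int i - 1) x)))"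
          and k="\<lambda>i. aut_pow \<alpha> (int i) (matrix_inv (A (it (- int i - 1) y)))"])
      fix i
      show "opnorm (matrix_inv (aut_pow \<alpha> (int i) (matrix_inv (A (it (- int i - 1) y))))) \<le> a * exp (\<rho> * real i)"
      proof -
        have "opnorm (aut_pow \<alpha> (int i) (A (it (- int i - 1) y)))
          \<le> D * exp (\<rho> * of_int \<bar>int i\<bar>) * opnorm (A (it (- int i - 1) y))"
          by (rule D3) (simp add: inv)
        also have "\<dots> \<le> D * exp (\<rho> * of_int \<bar>int i\<bar>) * (exp \<rho> * M)"
          using D M(1) M(3)[of "it (- int i - 1) y"]
            mult_mono[of 1 "exp \<rho>" "opnorm (A (it (- int i - 1) y))" M]
          by (intro mult_left_mono) (simp_all add: opnorm_nonneg)
        finally show ?thesis by (simp add: aut_pow_inv gl_simps aut_pow_invertible inv a_def mult_ac)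
      qed
      show "opnorm (aut_pow \<alpha> (int i) (matrix_inv (A (it (- int i - 1) x)))
            - aut_pow \<alpha> (int i) (matrix_inv (A (it (- int i - 1) y))))
          \<le> b * exp (\<rho> * real i) * \<Delta> i powr \<nu>" if i: "i < n"
      proof -
        let ?u = "it (- int i - 1) x" and ?v = "it (- int i - 1) y"
        have "opnorm (aut_pow \<alpha> (int i) (matrix_inv (A ?u)) - aut_pow \<alpha> (int i) (matrix_inv (A ?v)))
          \<le> D * exp (\<rho> * of_int \<bar>int i\<bar>) * opnorm (matrix_inv (A ?u) - matrix_inv (A ?v))"
          by (rule D2) (simp_all add: inv gl_simps)
        also have "\<dots> \<le> D * exp (\<rho> * of_int \<bar>int i\<bar>) * (M * M * (H * \<Delta> i powr \<nu>))"
        proof (rule mult_left_mono)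
          have "M * M * (H * dist ?u ?v powr \<nu>) \<le> M * M * (H * \<Delta> i powr \<nu>)"
            using M H(1) mono\<Delta>[OF zero_le_dist \<Delta>[OF i]] by (intro mult_left_mono) auto
          then show "opnorm (matrix_inv (A ?u) - matrix_inv (A ?v)) \<le> M * M * (H * \<Delta> i powr \<nu>)"
            using inv_diff[of ?u ?v] by linarith
        qed (use D in simp)
        also have "\<dots> \<le> exp \<rho> * (D * exp (\<rho> * of_int \<bar>int i\<bar>) * (M * M * (H * \<Delta> i powr \<nu>)))"
          using D M H mult_right_mono[of 1 "exp \<rho>" "D * exp (\<rho> * of_int \<bar>int i\<bar>) * (M * M * (H * \<Delta> i powr \<nu>))"]
          by simp
        finally show ?thesis by (simp add: b_def mult_ac)
      qed
      show "opnorm (untwisted A (- int i) y) * opnorm (matrix_inv (untwisted A (- int i) y)) \<le> D * exp (\<theta> * real i)"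
        using cond[of "- int i" y] by simp
      let ?k = "\<lambda>z. aut_pow \<alpha> (int i) (matrix_inv (A (it (- int i - 1) z)))"
      show "untwisted A (- int (Suc i)) x = ?k x ** untwisted A (- int i) x"
        "untwisted A (- int (Suc i)) y = ?k y ** untwisted A (- int i) y"
        by (rule step)+
      show "invertible (untwisted A (- int i) y)" by (rule untwisted_invertible[of A, OF inv])
      show "invertible (?k y)" by (intro aut_pow_invertible invertible_matrix_inv inv)
    qed (simp_all add: untwisted_0)
  qed (use c0 nu in auto)
qed

text \<open>Two regimes. On a stable or unstable leg distances decay like
  \<open>exp (- l * i)\<close>, and \<sigma> < \<nu> l makes the weighted series converge. For
  orbits only known to stay within \<Delta> of each other, the weights sum to order
  \<open>exp (\<sigma> * n)\<close>.\<close>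

lemma ratio_distortion:
  assumes A: "holder_GL \<nu> A" "fiber_bunched f l \<nu> \<alpha> A"
    and B: "holder_GL \<nu> B" "fiber_bunched f l \<nu> \<alpha> B"
  obtains c1 c2 \<sigma> where "c1 > 0" "c2 > 0" "0 < \<sigma>" "\<sigma> < \<nu> * l" "\<nu> > 0"
    "\<And>x y n. x \<in> stable_set f \<epsilon> y \<Longrightarrow>
      near_by (c1 * dist x y powr \<nu>) (ratio A B (int n) x) (ratio A B (int n) y)"
    "\<And>x y n. x \<in> unstable_set f \<epsilon> y \<Longrightarrow>
      near_by (c1 * dist x y powr \<nu>) (ratio A B (- int n) x) (ratio A B (- int n) y)"
    "\<And>x y n \<Delta>. (\<And>i. 0 \<le> i \<Longrightarrow> i \<le> int n \<Longrightarrow> dist (it i x) (it i y) \<le> \<Delta>) \<Longrightarrow>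
      near_by (c2 * exp (\<sigma> * real n) * \<Delta> powr \<nu>) (ratio A B (int n) x) (ratio A B (int n) y)"
    "\<And>x y n \<Delta>. (\<And>i. 0 \<le> i \<Longrightarrow> i \<le> int n \<Longrightarrow> dist (it (- i) x) (it (- i) y) \<le> \<Delta>) \<Longrightarrow>
      near_by (c2 * exp (\<sigma> * real n) * \<Delta> powr \<nu>) (ratio A B (- int n) x) (ratio A B (- int n) y)"
proof -
  have inv: "\<And>x. invertible (A x)" "\<And>x. invertible (B x)"
    using A(1) B(1) by (simp_all add: holder_GL_def carrier_GL)
  note near = ratio_near_by[of A B, OF inv]
  show ?thesis
  proof (rule untwisted_distortion[OF A])
    fix cA \<sigma>A
    assume a: "cA > 0" "0 < \<sigma>A" "\<sigma>A < \<nu> * l" "\<nu> > 0"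
      and a1: "\<And>c \<sigma> x y n \<Delta>. \<lbrakk>c \<ge> cA; \<sigma> \<ge> \<sigma>A; \<And>i. i < n \<Longrightarrow> dist (it (int i) x) (it (int i) y) \<le> \<Delta> i\<rbrakk> \<Longrightarrow>
        opnorm (matrix_inv (untwisted A (int n) y) ** untwisted A (int n) x - mat 1)
          \<le> exp (c * (\<Sum>i<n. exp (\<sigma> * real i) * \<Delta> i powr \<nu>)) - 1"
      and a2: "\<And>c \<sigma> x y n \<Delta>. \<lbrakk>c \<ge> cA; \<sigma> \<ge> \<sigma>A; \<And>i. i < n \<Longrightarrow> dist (it (- int i - 1) x) (it (- int i - 1) y) \<le> \<Delta> i\<rbrakk> \<Longrightarrow>
        opnorm (matrix_inv (untwisted A (- int n) y) ** untwisted A (- int n) x - mat 1)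
          \<le> exp (c * (\<Sum>i<n. exp (\<sigma> * real i) * \<Delta> i powr \<nu>)) - 1"
    show ?thesis
    proof (rule untwisted_distortion[OF B])
      fix cB \<sigma>B
      assume b: "cB > 0" "0 < \<sigma>B" "\<sigma>B < \<nu> * l" "\<nu> > 0"
        and b1: "\<And>c \<sigma> x y n \<Delta>. \<lbrakk>c \<ge> cB; \<sigma> \<ge> \<sigma>B; \<And>i. i < n \<Longrightarrow> dist (it (int i) x) (it (int i) y) \<le> \<Delta> i\<rbrakk> \<Longrightarrow>
          opnorm (matrix_inv (untwisted B (int n) y) ** untwisted B (int n) x - mat 1)
            \<le> exp (c * (\<Sum>i<n. exp (\<sigma> * real i) * \<Delta> i powr \<nu>)) - 1"
        and b2: "\<And>c \<sigma> x y n \<Delta>. \<lbrakk>c \<ge> cB; \<sigma> \<ge> \<sigma>B; \<And>i. i < n \<Longrightarrow> dist (it (- int i - 1) x) (it (- int i - 1) y) \<le> \<Delta> i\<rbrakk> \<Longrightarrow>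
          opnorm (matrix_inv (untwisted B (- int n) y) ** untwisted B (- int n) x - mat 1)
            \<le> exp (c * (\<Sum>i<n. exp (\<sigma> * real i) * \<Delta> i powr \<nu>)) - 1"
      define c \<sigma> where "c = max cA cB" and "\<sigma> = max \<sigma>A \<sigma>B"
      have c: "c \<ge> cA" "c \<ge> cB" "\<sigma> \<ge> \<sigma>A" "\<sigma> \<ge> \<sigma>B" "c > 0" "0 < \<sigma>" "\<sigma> < \<nu> * l"
        using a b by (auto simp: c_def \<sigma>_def)
      have fwd: "near_by (c * (\<Sum>i<n. exp (\<sigma> * real i) * \<Delta> i powr \<nu>)) (ratio A B (int n) x) (ratio A B (int n) y)"
        if "\<And>i. i < n \<Longrightarrow> dist (it (int i) x) (it (int i) y) \<le> \<Delta> i" for x y n \<Delta>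
        by (rule near[OF a1[OF c(1,3)] b1[OF c(2,4)]]) (use that in \<open>simp_all add: dist_commute\<close>)
      have bwd: "near_by (c * (\<Sum>i<n. exp (\<sigma> * real i) * \<Delta> i powr \<nu>)) (ratio A B (- int n) x) (ratio A B (- int n) y)"
        if "\<And>i. i < n \<Longrightarrow> dist (it (- int i - 1) x) (it (- int i - 1) y) \<le> \<Delta> i" for x y n \<Delta>
        by (rule near[OF a2[OF c(1,3)] b2[OF c(2,4)]]) (use that in \<open>simp_all add: dist_commute\<close>)
      define c1 where "c1 = c * (C powr \<nu> / (1 - exp (\<sigma> - \<nu> * l)))"
      define c2 where "c2 = c / (exp \<sigma> - 1)"
      have c12: "c1 > 0" "c2 > 0" using c pos by (simp_all add: c1_def c2_def)
      have geo: "c * (\<Sum>i<n. exp (\<sigma> * real i) * (C * exp (- l * real i) * d) powr \<nu>) \<le> c1 * d powr \<nu>"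
        if d: "d \<ge> 0" for n :: nat and d
      proof -
        have "exp (\<sigma> * real i) * (C * exp (- l * real i) * d) powr \<nu>
            = C powr \<nu> * d powr \<nu> * exp ((\<sigma> - \<nu> * l) * real i)" for i
        proof -
          have "exp (\<sigma> * real i) * exp (- l * real i * \<nu>) = exp ((\<sigma> - \<nu> * l) * real i)"
            unfolding exp_add[symmetric] by (simp add: algebra_simps)
          then show ?thesis using pos d by (simp add: powr_mult powr_def[of "exp _"] mult_ac)
        qed
        then have "(\<Sum>i<n. exp (\<sigma> * real i) * (C * exp (- l * real i) * d) powr \<nu>)
            = C powr \<nu> * d powr \<nu> * (\<Sum>i<n. exp ((\<sigma> - \<nu> * l) * real i))"
          by (simp add: sum_distrib_left)
        also have "\<dots> \<le> C powr \<nu> * d powr \<nu> * (1 / (1 - exp (\<sigma> - \<nu> * l)))"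
          using c by (intro mult_left_mono sum_exp_neg_le) auto
        finally show ?thesis
          by (rule order_trans[OF mult_left_mono[OF _ less_imp_le[OF c(5)]]]) (simp add: c1_def)
      qed
      have const: "c * (\<Sum>i<n. exp (\<sigma> * real i) * \<Delta> powr \<nu>) \<le> c2 * exp (\<sigma> * real n) * \<Delta> powr \<nu>"
        for n :: nat and \<Delta>
      proof -
        have "c * (\<Sum>i<n. exp (\<sigma> * real i)) * \<Delta> powr \<nu> \<le> c * (exp (\<sigma> * real n) / (exp \<sigma> - 1)) * \<Delta> powr \<nu>"
          using c by (intro mult_right_mono mult_left_mono sum_exp_le) auto
        then show ?thesis by (simp add: c2_def sum_distrib_left mult_ac)
      qed
      show ?thesis
      proof (rule that[OF c12 c(6,7) a(4)])
        fix x y n assume x: "x \<in> stable_set f \<epsilon> y"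
        show "near_by (c1 * dist x y powr \<nu>) (ratio A B (int n) x) (ratio A B (int n) y)"
        proof (rule near_by_mono[OF fwd geo])
          show "dist (it (int i) x) (it (int i) y) \<le> C * exp (- l * real i) * dist x y" for i
            using stable_contract[OF x self_in_stable, of "int i"] by simp
        qed simp
      next
        fix x y n assume x: "x \<in> unstable_set f \<epsilon> y"
        show "near_by (c1 * dist x y powr \<nu>) (ratio A B (- int n) x) (ratio A B (- int n) y)"
        proof (rule near_by_mono[OF bwd geo])
          fix i :: nat
          \<comment> \<open>The backward factor of index \<open>i\<close> sits at time
            \<open>-i - 1\<close>; the extra unit of contraction is given away.\<close>
          have step: "- int i - 1 = - (int i + 1)" by simp
          have "dist (it (- int i - 1) x) (it (- int i - 1) y) \<le> C * exp (- l * of_int (int i + 1)) * dist x y"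
            unfolding step by (rule unstable_contract[OF x self_in_unstable]) simp
          also have "\<dots> \<le> C * exp (- l * real i) * dist x y"
            using pos by (intro mult_right_mono mult_left_mono) (auto simp: algebra_simps)
          finally show "dist (it (- int i - 1) x) (it (- int i - 1) y) \<le> C * exp (- l * real i) * dist x y" .
        qed simp
      next
        fix x y n \<Delta> assume x: "\<And>i. 0 \<le> i \<Longrightarrow> i \<le> int n \<Longrightarrow> dist (it i x) (it i y) \<le> \<Delta>"
        show "near_by (c2 * exp (\<sigma> * real n) * \<Delta> powr \<nu>) (ratio A B (int n) x) (ratio A B (int n) y)"
          by (rule near_by_mono[OF fwd const]) (simp add: x)
      next
        fix x y n \<Delta> assume x: "\<And>i. 0 \<le> i \<Longrightarrow> i \<le> int n \<Longrightarrow> dist (it (- i) x) (it (- i) y) \<le> \<Delta>"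
        show "near_by (c2 * exp (\<sigma> * real n) * \<Delta> powr \<nu>) (ratio A B (- int n) x) (ratio A B (- int n) y)"
        proof (rule near_by_mono[OF bwd const])
          show "dist (it (- int i - 1) x) (it (- int i - 1) y) \<le> \<Delta>" if "i < n" for i
            using x[of "int i + 1"] that by simp
        qed
      qed
    qed
  qed
qed

section \<open>Comparison along periodic and dense orbits\<close>

lemma it_mult_fixed:
  assumes "it N r = r"
  shows "it (s * N) r = r"
proof (induction s rule: int_induct[where k=0])
  case base
  then show ?case by (simp add: int_iterate_0)
next
  case (step1 i)
  then show ?case using it_it[of N "i * N" r] assms by (simp add: algebra_simps)
next
  case (step2 i)
  have "it (- N) r = r" using it_it[of "- N" N r] assms by (simp add: int_iterate_0)
  then show ?case using it_it[of "- N" "i * N" r] step2 by (simp add: algebra_simps)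
qed

lemma tendsto_exp_neg_mult:
  assumes "a < (0::real)"
  shows "(\<lambda>s. exp (a * real s)) \<longlonglongrightarrow> 0"
proof -
  have "(\<lambda>s. exp a ^ s) \<longlonglongrightarrow> 0" using assms by (intro LIMSEQ_power_zero) simp
  then show ?thesis by (simp add: exp_of_nat2_mult)
qed

text \<open>For two nearby points \<open>y\<close>, \<open>y'\<close> of one periodic orbit, the point \<open>[y', y]\<close> is asymptotic to that orbit
  in both time directions. Closing longer and longer segments of its orbit transfers the periodic
  data, which makes the stable and unstable comparisons at \<open>[y', y]\<close> agree.\<close>

lemma periodic_ratio_near_by:
  assumes A: "holder_GL \<nu> A" "fiber_bunched f l \<nu> \<alpha> A"
    and B: "holder_GL \<nu> B" "fiber_bunched f l \<nu> \<alpha> B"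
    and periodic: "\<And>n p. it n p = p \<Longrightarrow> twisted_cocycle f \<alpha> A n p = twisted_cocycle f \<alpha> B n p"
  obtains K \<delta> where "K > 0" "\<delta> > 0"
    "\<And>r N i j \<eta>. \<lbrakk>N > 0; it N r = r; dist (it i r) (it j r) \<le> \<delta>; \<eta> > 0\<rbrakk> \<Longrightarrow>
      near_by (K * dist (it i r) (it j r) powr \<nu> + \<eta>) (ratio A B (- i) (it i r)) (ratio A B (- j) (it j r))"
proof -
  have inv: "\<And>x. invertible (A x)" "\<And>x. invertible (B x)"
    using A(1) B(1) by (simp_all add: holder_GL_def carrier_GL)
  show ?thesis
  proof (rule ratio_distortion[OF A B])
    fix c1 c2 \<sigma>
    assume c: "c1 > 0" "c2 > 0" "0 < \<sigma>" "\<sigma> < \<nu> * l" "\<nu> > 0"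
      and S: "\<And>x y n. x \<in> stable_set f \<epsilon> y \<Longrightarrow>
        near_by (c1 * dist x y powr \<nu>) (ratio A B (int n) x) (ratio A B (int n) y)"
      and U: "\<And>x y n. x \<in> unstable_set f \<epsilon> y \<Longrightarrow>
        near_by (c1 * dist x y powr \<nu>) (ratio A B (- int n) x) (ratio A B (- int n) y)"
      and F: "\<And>x y n \<Delta>. (\<And>i. 0 \<le> i \<Longrightarrow> i \<le> int n \<Longrightarrow> dist (it i x) (it i y) \<le> \<Delta>) \<Longrightarrow>
        near_by (c2 * exp (\<sigma> * real n) * \<Delta> powr \<nu>) (ratio A B (int n) x) (ratio A B (int n) y)"
      and G: "\<And>x y n \<Delta>. (\<And>i. 0 \<le> i \<Longrightarrow> i \<le> int n \<Longrightarrow> dist (it (- i) x) (it (- i) y) \<le> \<Delta>) \<Longrightarrow>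
        near_by (c2 * exp (\<sigma> * real n) * \<Delta> powr \<nu>) (ratio A B (- int n) x) (ratio A B (- int n) y)"
    obtain Kb \<delta>b where Kb: "Kb \<ge> 1" "\<delta>b > 0" and bracket:
      "\<And>x y. dist x y \<le> \<delta>b \<Longrightarrow> \<exists>z. z \<in> stable_set f \<epsilon> x \<and> z \<in> unstable_set f \<epsilon> y
          \<and> dist x z \<le> Kb * dist x y \<and> dist y z \<le> Kb * dist x y"
      by (rule bracket_lipschitz) blast
    obtain Kc \<delta>c and n0 :: nat where Kc: "Kc > 0" "\<delta>c > 0" and close:
      "\<And>x n. n \<ge> int n0 \<Longrightarrow> dist x (it n x) \<le> \<delta>c \<Longrightarrow>
         \<exists>q. it n q = q \<and> (\<forall>i. 0 \<le> i \<longrightarrow> i \<le> n \<longrightarrow> dist (it i x) (it i q) \<le> Kc * dist x (it n x))"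
      by (rule closing) blast
    \<comment> \<open>One term \<open>c1 * Kb powr \<nu>\<close> for each of the two legs of the
      bracket.\<close>
    define K where "K = 2 * c1 * Kb powr \<nu>"
    show ?thesis
    proof (rule that[of K \<delta>b])
      show "K > 0" using c Kb by (simp add: K_def)
      show "\<delta>b > 0" by (rule Kb)
    next
      fix r and N i j :: int and \<eta> :: real
      assume N: "N > 0" "it N r = r" and d: "dist (it i r) (it j r) \<le> \<delta>b" and \<eta>: "\<eta> > 0"
      define y y' where "y = it i r" and "y' = it j r"
      obtain w where w: "w \<in> stable_set f \<epsilon> y'" "w \<in> unstable_set f \<epsilon> y"
        "dist y' w \<le> Kb * dist y y'" "dist y w \<le> Kb * dist y y'"
        using bracket[of y' y] d by (auto simp: y_def y'_def dist_commute)
      \<comment> \<open>Multiples of the period are shifted so that \<open>y\<close> at time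
        \<open>- m s\<close> and \<open>y'\<close> at time \<open>n s\<close> are both at
        \<open>r\<close>. Both ends of the orbit segment of \<open>w\<close> therefore approach
        \<open>r\<close>, which makes the gap \<open>D s\<close> small.\<close>
      define n m where "n = (\<lambda>s. int s * N - j)" and "m = (\<lambda>s. int s * N + i)"
      define D where "D = (\<lambda>s. dist (it (- m s) w) (it (n s) w))"
      define R where "R = C * exp (- l * of_int i) * dist w y + C * exp (l * of_int j) * dist w y'"
      have large: "\<forall>\<^sub>F s in sequentially. n s \<ge> 0 \<and> m s \<ge> 0 \<and> m s + n s \<ge> int n0"
        using eventually_ge_at_top[of "nat (\<bar>i\<bar> + \<bar>j\<bar> + int n0)"]
      proof eventually_elim
        case (elim s)
        have "int s \<le> int s * N" using N(1) by (simp add: mult_le_cancel_left1)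
        moreover have "\<bar>i\<bar> + \<bar>j\<bar> + int n0 \<le> int s" using elim by linarith
        ultimately show ?case unfolding n_def m_def by (intro conjI; linarith)
      qed
      have D_le: "D s \<le> R * exp (- l * of_int N * real s)" if "n s \<ge> 0" "m s \<ge> 0" for s
      proof -
        have "it (- m s) y = r"
          using it_mult_fixed[OF N(2), of "- int s"] by (simp add: y_def it_it m_def algebra_simps)
        then have "dist (it (- m s) w) r \<le> C * exp (- l * of_int (m s)) * dist w y"
          using unstable_contract[OF w(2) self_in_unstable that(2)] by simp
        moreover have "it (n s) y' = r"
          using it_mult_fixed[OF N(2), of "int s"] by (simp add: y'_def it_it n_def)
        then have "dist (it (n s) w) r \<le> C * exp (- l * of_int (n s)) * dist w y'"
          using stable_contract[OF w(1) self_in_stable that(1)] by simp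
        ultimately have "D s \<le> C * exp (- l * of_int (m s)) * dist w y + C * exp (- l * of_int (n s)) * dist w y'"
          unfolding D_def using dist_triangle2[of "it (- m s) w" "it (n s) w" r] by linarith
        also have "exp (- l * of_int (m s)) = exp (- l * of_int i) * exp (- l * of_int N * real s)"
          unfolding exp_add[symmetric] by (simp add: m_def algebra_simps)
        also have "exp (- l * of_int (n s)) = exp (l * of_int j) * exp (- l * of_int N * real s)"
          unfolding exp_add[symmetric] by (simp add: n_def algebra_simps)
        finally show ?thesis by (simp add: R_def algebra_simps)
      qed
      have R0: "R \<ge> 0" using pos by (simp add: R_def)
      have "(\<lambda>s. R * exp (- l * of_int N * real s)) \<longlonglongrightarrow> 0"
        using pos N by (intro tendsto_mult_right_zero tendsto_exp_neg_mult) (simp add: mult_neg_pos)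
      then have "\<forall>\<^sub>F s in sequentially. R * exp (- l * of_int N * real s) < \<delta>c"
        using Kc(2) by (rule order_tendstoD)
      moreover
      \<comment> \<open>Coefficient of the total shadowing cost: the two halves contribute
        \<open>exp (\<sigma> * m s)\<close> and \<open>exp (\<sigma> * n s)\<close>, and the shifts
        \<open>i\<close> and \<open>j\<close> are split off here.\<close>
      define E where "E = c2 * (Kc * R) powr \<nu> * (exp (\<sigma> * of_int i) + exp (- \<sigma> * of_int j))"
      have "(\<sigma> - \<nu> * l) * of_int N < 0" using c N by (intro mult_neg_pos) auto
      then have "(\<lambda>s. E * exp ((\<sigma> - \<nu> * l) * of_int N * real s)) \<longlonglongrightarrow> 0"
        by (intro tendsto_mult_right_zero tendsto_exp_neg_mult)
      then have "\<forall>\<^sub>F s in sequentially. E * exp ((\<sigma> - \<nu> * l) * of_int N * real s) < \<eta>"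
        using \<eta> by (rule order_tendstoD)
      ultimately have "\<forall>\<^sub>F s in sequentially. R * exp (- l * of_int N * real s) < \<delta>c \<and>
        E * exp ((\<sigma> - \<nu> * l) * of_int N * real s) < \<eta> \<and> n s \<ge> 0 \<and> m s \<ge> 0 \<and> m s + n s \<ge> int n0"
        using large by eventually_elim auto
      then obtain s where s: "R * exp (- l * of_int N * real s) < \<delta>c"
        "E * exp ((\<sigma> - \<nu> * l) * of_int N * real s) < \<eta>" "n s \<ge> 0" "m s \<ge> 0" "m s + n s \<ge> int n0"
        by (auto dest: eventually_happens)
      define x where "x = it (- m s) w"
      have "it (m s + n s) x = it (n s) w" by (simp add: x_def it_it)
      then have Dx: "D s = dist x (it (m s + n s) x)" by (simp add: D_def x_def)
      then have "dist x (it (m s + n s) x) \<le> \<delta>c" using D_le[OF s(3,4)] s(1) by linarith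
      from close[OF s(5) this] obtain q0 where q0: "it (m s + n s) q0 = q0"
        "\<And>t. 0 \<le> t \<Longrightarrow> t \<le> m s + n s \<Longrightarrow> dist (it t x) (it t q0) \<le> Kc * D s"
        unfolding Dx by blast
      \<comment> \<open>Closing starts at the left end of the segment; \<open>q\<close> is the point
        of the closed orbit that accompanies \<open>w\<close> at time 0.\<close>
      define q where "q = it (m s) q0"
      have wq: "dist (it t w) (it t q) \<le> Kc * D s" if "- m s \<le> t" "t \<le> n s" for t
        using q0(2)[of "t + m s"] that by (simp add: x_def q_def it_it)
      define k where "k = Kc * D s"
      have fwd: "near_by (c2 * exp (\<sigma> * of_int (n s)) * k powr \<nu>) (ratio A B (n s) q) (ratio A B (n s) w)"
        using F[of "nat (n s)" q w k] wq s(3,4) by (simp add: k_def dist_commute)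
      have bwd: "near_by (c2 * exp (\<sigma> * of_int (m s)) * k powr \<nu>) (ratio A B (- m s) w) (ratio A B (- m s) q)"
        using G[of "nat (m s)" w q k] wq s(3,4) by (simp add: k_def)
      have "near_by (c1 * dist w y' powr \<nu>) (ratio A B (n s) w) (ratio A B (n s) y')"
        using S[OF w(1), of "nat (n s)"] s(3) by simp
      moreover have "ratio A B (n s) y' = ratio A B (- j) y'"
        by (rule ratio_periodic[OF inv periodic])
          (use it_mult_fixed[OF N(2), of "int s"] in \<open>simp_all add: y'_def it_it n_def int_iterate_0\<close>)
      ultimately have 4: "near_by (c1 * dist w y' powr \<nu>) (ratio A B (n s) w) (ratio A B (- j) y')" by simp
      have "y \<in> unstable_set f \<epsilon> w" using w(2) by (simp add: unstable_set_def dist_commute)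
      then have "near_by (c1 * dist w y powr \<nu>) (ratio A B (- m s) y) (ratio A B (- m s) w)"
        using U[of y w "nat (m s)"] s(4) by (simp add: dist_commute)
      moreover have "ratio A B (- m s) y = ratio A B (- i) y"
        by (rule ratio_periodic[OF inv periodic])
          (use it_mult_fixed[OF N(2), of "- int s"] in \<open>simp_all add: y_def it_it m_def int_iterate_0\<close>)
      ultimately have 1: "near_by (c1 * dist w y powr \<nu>) (ratio A B (- i) y) (ratio A B (- m s) w)" by simp
      \<comment> \<open>\<open>q\<close> has period \<open>m s + n s\<close>, so the two times lead
        to the same point. This link carries the comparison from the past of \<open>w\<close> to its
        future.\<close>
      have "ratio A B (- m s) q = ratio A B (n s) q"
        by (rule ratio_periodic[OF inv periodic])
          (use q0(1) in \<open>simp_all add: q_def it_it int_iterate_0 add.commute\<close>)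
      with bwd have 2: "near_by (c2 * exp (\<sigma> * of_int (m s)) * k powr \<nu>) (ratio A B (- m s) w) (ratio A B (n s) q)"
        by simp
      \<comment> \<open>The chain visits \<open>y\<close>, \<open>w\<close>, \<open>q\<close> in the
        past and \<open>q\<close>, \<open>w\<close>, \<open>y'\<close> in the future; the outer
        links give the Hoelder term, the two links between \<open>w\<close> and \<open>q\<close> the
        error \<eta>.\<close>
      note chain = near_by_trans[OF near_by_trans[OF near_by_trans[OF 1 2] fwd] 4]
      have "k powr \<nu> \<le> (Kc * (R * exp (- l * of_int N * real s))) powr \<nu>"
        unfolding k_def using Kc c D_le[OF s(3,4)] by (intro powr_mono2 mult_left_mono) (auto simp: D_def)
      also have "\<dots> = (Kc * R) powr \<nu> * exp (- \<nu> * l * of_int N * real s)"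
        using Kc R0 by (simp add: powr_mult powr_def[of "exp _"] mult_ac)
      finally have k: "k powr \<nu> \<le> (Kc * R) powr \<nu> * exp (- \<nu> * l * of_int N * real s)" .
      have "c2 * exp (\<sigma> * of_int (m s)) * k powr \<nu> + c2 * exp (\<sigma> * of_int (n s)) * k powr \<nu>
         = c2 * (exp (\<sigma> * of_int (m s)) + exp (\<sigma> * of_int (n s))) * k powr \<nu>"
        by (simp add: algebra_simps)
      also have "\<dots> \<le> c2 * (exp (\<sigma> * of_int (m s)) + exp (\<sigma> * of_int (n s))) *
          ((Kc * R) powr \<nu> * exp (- \<nu> * l * of_int N * real s))"
        using k c by (intro mult_left_mono) auto
      also have "\<dots> = E * exp ((\<sigma> - \<nu> * l) * of_int N * real s)"
      proof -
        have "exp (\<sigma> * of_int (m s)) * exp (- \<nu> * l * of_int N * real s)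
            = exp (\<sigma> * of_int i) * exp ((\<sigma> - \<nu> * l) * of_int N * real s)"
          unfolding exp_add[symmetric] by (simp add: m_def algebra_simps)
        moreover have "exp (\<sigma> * of_int (n s)) * exp (- \<nu> * l * of_int N * real s)
            = exp (- \<sigma> * of_int j) * exp ((\<sigma> - \<nu> * l) * of_int N * real s)"
          unfolding exp_add[symmetric] by (simp add: n_def algebra_simps)
        ultimately have "(exp (\<sigma> * of_int (m s)) + exp (\<sigma> * of_int (n s))) * exp (- \<nu> * l * of_int N * real s)
          = (exp (\<sigma> * of_int i) + exp (- \<sigma> * of_int j)) * exp ((\<sigma> - \<nu> * l) * of_int N * real s)"
          by (simp add: distrib_right)
        then show ?thesis by (simp add: E_def mult_ac)
      qed
      finally have small: "c2 * exp (\<sigma> * of_int (m s)) * k powr \<nu> + c2 * exp (\<sigma> * of_int (n s)) * k powr \<nu> \<le> \<eta>"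
        using s(2) by linarith
      have leg: "c1 * u powr \<nu> \<le> c1 * (Kb powr \<nu> * dist y y' powr \<nu>)" if "0 \<le> u" "u \<le> Kb * dist y y'" for u
        using powr_mono2[OF less_imp_le[OF c(5)] that] c Kb
        by (intro mult_left_mono) (auto simp: powr_mult)
      have "near_by (K * dist y y' powr \<nu> + \<eta>) (ratio A B (- i) y) (ratio A B (- j) y')"
      proof (rule near_by_mono[OF chain])
        show "c1 * dist w y powr \<nu> + c2 * exp (\<sigma> * of_int (m s)) * k powr \<nu> +
            c2 * exp (\<sigma> * of_int (n s)) * k powr \<nu> + c1 * dist w y' powr \<nu> \<le> K * dist y y' powr \<nu> + \<eta>"
          using small leg[of "dist w y"] leg[of "dist w y'"] w(3,4)
          by (simp add: K_def dist_commute mult_ac)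
      qed
      then show "near_by (K * dist (it i r) (it j r) powr \<nu> + \<eta>) (ratio A B (- i) (it i r)) (ratio A B (- j) (it j r))"
        by (simp add: y_def y'_def)
    qed
  qed
qed

section \<open>Recurrence of the dense orbit and its approximation by periodic orbits\<close>

lemma dense_orbit_recurrent:
  assumes "transitive_map f"
  obtains x0 where "closure (range (\<lambda>n. it (int n) x0)) = UNIV"
    "\<And>N0 \<eta>. \<eta> > 0 \<Longrightarrow> \<exists>N\<ge>int N0. dist x0 (it N x0) < \<eta>"
proof -
  obtain x0 where x0: "closure (range (\<lambda>n. it (int n) x0)) = UNIV"
    using assms by (auto simp: transitive_map_def int_iterate_of_nat)
  moreover have "\<exists>N\<ge>int N0. dist x0 (it N x0) < \<eta>" if \<eta>: "\<eta> > 0" for N0 \<eta>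
  proof -
    \<comment> \<open>Aiming at \<open>x0\<close> itself could return time 0; aiming at its
      \<open>N0\<close>-th preimage and moving on by \<open>N0\<close> steps makes the return time
      at least \<open>N0\<close>.\<close>
    define u where "u = it (- int N0) x0"
    have iu: "it (int N0) u = x0" by (simp add: u_def it_it int_iterate_0)
    obtain d where d: "d > 0" "\<And>z. dist z u < d \<Longrightarrow> dist (it (int N0) z) (it (int N0) u) < \<eta>"
      using continuous_on_it[of "int N0"] \<eta> unfolding continuous_on_iff by (metis UNIV_I)
    have "u \<in> closure (range (\<lambda>n. it (int n) x0))" using x0 by simp
    then obtain n where "dist (it (int n) x0) u < d"
      using d(1) by (auto simp: closure_approachable)
    from d(2)[OF this] have "dist x0 (it (int N0 + int n) x0) < \<eta>"
      by (simp add: iu it_it dist_commute)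
    then show ?thesis by (intro exI[of _ "int N0 + int n"]) simp
  qed
  ultimately show ?thesis by (rule that)
qed

lemma recurrent_periodic_approx:
  assumes rec: "\<And>N0 \<eta>. \<eta> > 0 \<Longrightarrow> \<exists>N\<ge>int N0. dist x0 (it N x0) < \<eta>" and \<eta>: "\<eta> > 0"
  shows "\<exists>r N. N > 0 \<and> it N r = r \<and> dist x0 r < \<eta>"
proof -
  obtain K \<delta> and n0 :: nat where K: "K > 0" "\<delta> > 0" and close:
    "\<And>x n. n \<ge> int n0 \<Longrightarrow> dist x (it n x) \<le> \<delta> \<Longrightarrow>
       \<exists>q. it n q = q \<and> (\<forall>i. 0 \<le> i \<longrightarrow> i \<le> n \<longrightarrow> dist (it i x) (it i q) \<le> K * dist x (it n x))"
    by (rule closing) blast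
  \<comment> \<open>\<open>Suc n0\<close> keeps the period positive even if \<open>n0\<close> is
    0.\<close>
  obtain N where N: "N \<ge> int (Suc n0)" "dist x0 (it N x0) < min \<delta> (\<eta> / K)"
    using rec[of "min \<delta> (\<eta> / K)" "Suc n0"] K \<eta> by auto
  obtain q where "it N q = q" "dist (it 0 x0) (it 0 q) \<le> K * dist x0 (it N x0)"
    using close[of N x0] N by auto
  moreover have "K * dist x0 (it N x0) < \<eta>" using N(2) K by (simp add: field_simps)
  ultimately show ?thesis using N(1) by (intro exI[of _ q] exI[of _ N]) (simp add: int_iterate_0)
qed

text \<open>The periods of the approximating orbits are uncontrolled, but \<open>i\<close> and
  \<open>j\<close> are fixed before the approximation improves: replacing \<open>x0\<close> by a
  periodic point distorts the ratios over \<open>i\<close> or \<open>j\<close> steps only, and the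
  periodic estimate has a constant independent of the orbit.\<close>

lemma dense_orbit_ratio_near_by:
  assumes A: "holder_GL \<nu> A" "fiber_bunched f l \<nu> \<alpha> A"
    and B: "holder_GL \<nu> B" "fiber_bunched f l \<nu> \<alpha> B"
    and periodic: "\<And>n p. it n p = p \<Longrightarrow> twisted_cocycle f \<alpha> A n p = twisted_cocycle f \<alpha> B n p"
    and rec: "\<And>N0 \<eta>. \<eta> > 0 \<Longrightarrow> \<exists>N\<ge>int N0. dist x0 (it N x0) < \<eta>"
  obtains K \<delta> where "K > 0" "\<delta> > 0" "\<nu> > 0"
    "\<And>i j :: nat. \<And>\<eta>. \<lbrakk>dist (it (int i) x0) (it (int j) x0) < \<delta>; \<eta> > 0\<rbrakk> \<Longrightarrow>
      near_by (K * dist (it (int i) x0) (it (int j) x0) powr \<nu> + \<eta>)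
        (ratio A B (- int i) (it (int i) x0)) (ratio A B (- int j) (it (int j) x0))"
proof -
  show ?thesis
  proof (rule ratio_distortion[OF A B])
    fix c1 c2 \<sigma> :: real
    assume c: "c1 > 0" "c2 > 0" "\<nu> > 0"
      and G: "\<And>x y n \<Delta>. (\<And>i. 0 \<le> i \<Longrightarrow> i \<le> int n \<Longrightarrow> dist (it (- i) x) (it (- i) y) \<le> \<Delta>) \<Longrightarrow>
      near_by (c2 * exp (\<sigma> * real n) * \<Delta> powr \<nu>) (ratio A B (- int n) x) (ratio A B (- int n) y)"
    show ?thesis
    proof (rule periodic_ratio_near_by[OF A B periodic])
      fix K \<delta> :: real
      assume K: "K > 0" "\<delta> > 0" and
        near: "\<And>r N i j \<eta>. \<lbrakk>N > 0; it N r = r; dist (it i r) (it j r) \<le> \<delta>; \<eta> > 0\<rbrakk> \<Longrightarrow>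
          near_by (K * dist (it i r) (it j r) powr \<nu> + \<eta>) (ratio A B (- i) (it i r)) (ratio A B (- j) (it j r))"
      show ?thesis
      proof (rule that[OF K c(3)])
        fix i j :: nat and \<eta> :: real
        assume d: "dist (it (int i) x0) (it (int j) x0) < \<delta>" and \<eta>: "\<eta> > 0"
        obtain L where L: "L \<ge> 1" "\<And>n x y. dist (it (int n) x) (it (int n) y) \<le> L ^ n * dist x y"
          using lipschitz_iterate by metis
        have "\<forall>k. \<exists>r N. N > 0 \<and> it N r = r \<and> dist x0 r < 1 / real (Suc k)"
          using recurrent_periodic_approx[OF rec] by simp
        then obtain r N where r: "\<And>k. N k > 0" "\<And>k. it (N k) (r k) = r k"
          "\<And>k. dist x0 (r k) < 1 / real (Suc k)"
          by metis
        have dist0: "(\<lambda>k. dist x0 (r k)) \<longlonglongrightarrow> 0"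
          by (rule Lim_null_comparison[OF _ LIMSEQ_inverse_real_of_nat])
            (use r(3) in \<open>auto intro!: always_eventually less_imp_le simp: inverse_eq_divide\<close>)
        have "r \<longlonglongrightarrow> x0" using dist0 by (subst tendsto_dist_iff) (simp add: dist_commute)
        then have it_r: "(\<lambda>k. it n (r k)) \<longlonglongrightarrow> it n x0" for n
          using continuous_on_tendsto_compose[OF continuous_on_it] by fastforce
        define dk where "dk = (\<lambda>k. dist (it (int i) (r k)) (it (int j) (r k)))"
        have dk: "dk \<longlonglongrightarrow> dist (it (int i) x0) (it (int j) x0)"
          unfolding dk_def by (intro tendsto_dist it_r)
        \<comment> \<open>The cost of replacing \<open>x0\<close> by \<open>r k\<close> in the ratio
          at time \<open>-n\<close>; it need only vanish as \<open>k\<close> grows with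
          \<open>n\<close> fixed.\<close>
        define e where "e = (\<lambda>n k. c2 * exp (\<sigma> * real n) * (L ^ n * dist x0 (r k)) powr \<nu>)"
        have e: "e n \<longlonglongrightarrow> 0" for n
        proof -
          have "(\<lambda>k. (L ^ n * dist x0 (r k)) powr \<nu>) \<longlonglongrightarrow> (L ^ n * 0) powr \<nu>"
            using c L(1) by (intro tendsto_powr2 tendsto_mult dist0 tendsto_const) auto
          then show ?thesis
            unfolding e_def using tendsto_mult_right_zero by fastforce
        qed
        have transfer: "near_by (e n k) (ratio A B (- int n) (it (int n) x0)) (ratio A B (- int n) (it (int n) (r k)))"
          "near_by (e n k) (ratio A B (- int n) (it (int n) (r k))) (ratio A B (- int n) (it (int n) x0))"
          for n k
        proof -
          have *: "dist (it (- t) (it (int n) x0)) (it (- t) (it (int n) (r k))) \<le> L ^ n * dist x0 (r k)"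
            if t: "0 \<le> t" "t \<le> int n" for t
          proof -
            have "int n - t = int (nat (int n - t))" using t by simp
            then have "dist (it (int n - t) x0) (it (int n - t) (r k)) \<le> L ^ nat (int n - t) * dist x0 (r k)"
              using L(2)[of "nat (int n - t)"] by metis
            also have "\<dots> \<le> L ^ n * dist x0 (r k)"
              using L(1) t by (intro mult_right_mono power_increasing) auto
            finally show ?thesis by (simp add: it_it algebra_simps)
          qed
          show "near_by (e n k) (ratio A B (- int n) (it (int n) x0)) (ratio A B (- int n) (it (int n) (r k)))"
            "near_by (e n k) (ratio A B (- int n) (it (int n) (r k))) (ratio A B (- int n) (it (int n) x0))"
            unfolding e_def by (rule G, use * in \<open>simp add: dist_commute\<close>)+
        qed
        have "(\<lambda>k. e i k + (K * dk k powr \<nu> + \<eta> / 2) + e j k)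
            \<longlonglongrightarrow> 0 + (K * dist (it (int i) x0) (it (int j) x0) powr \<nu> + \<eta> / 2) + 0"
          using c by (intro tendsto_intros e tendsto_powr2 dk) (auto simp: dk_def)
        moreover have "0 + (K * dist (it (int i) x0) (it (int j) x0) powr \<nu> + \<eta> / 2) + 0
            < K * dist (it (int i) x0) (it (int j) x0) powr \<nu> + \<eta>" using \<eta> by simp
        ultimately have "\<forall>\<^sub>F k in sequentially. e i k + (K * dk k powr \<nu> + \<eta> / 2) + e j k
            < K * dist (it (int i) x0) (it (int j) x0) powr \<nu> + \<eta>"
          by (rule order_tendstoD)
        moreover have "\<forall>\<^sub>F k in sequentially. dk k < \<delta>" using dk d by (rule order_tendstoD)
        ultimately have "\<forall>\<^sub>F k in sequentially. e i k + (K * dk k powr \<nu> + \<eta> / 2) + e j k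
            < K * dist (it (int i) x0) (it (int j) x0) powr \<nu> + \<eta> \<and> dk k < \<delta>"
          by eventually_elim simp
        then obtain k where k: "e i k + (K * dk k powr \<nu> + \<eta> / 2) + e j k
            < K * dist (it (int i) x0) (it (int j) x0) powr \<nu> + \<eta>" "dk k < \<delta>"
          by (auto dest: eventually_happens)
        have "near_by (K * dk k powr \<nu> + \<eta> / 2) (ratio A B (- int i) (it (int i) (r k)))
            (ratio A B (- int j) (it (int j) (r k)))"
          unfolding dk_def by (rule near[OF r(1,2)]) (use k(2) \<eta> in \<open>simp_all add: dk_def\<close>)
        from near_by_trans[OF near_by_trans[OF transfer(1) this] transfer(2)]
        show "near_by (K * dist (it (int i) x0) (it (int j) x0) powr \<nu> + \<eta>)
            (ratio A B (- int i) (it (int i) x0)) (ratio A B (- int j) (it (int j) x0))"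
          by (rule near_by_mono) (use k(1) in simp)
      qed
    qed
  qed
qed

text \<open>A relative estimate becomes absolute once the ratios are bounded along the orbit. By
  compactness finitely many orbit points are \<delta>-dense, and the local estimate carries their
  bound to all others.\<close>

lemma dense_orbit_ratio_holder:
  assumes A: "holder_GL \<nu> A" "fiber_bunched f l \<nu> \<alpha> A"
    and B: "holder_GL \<nu> B" "fiber_bunched f l \<nu> \<alpha> B"
    and periodic: "\<And>n p. it n p = p \<Longrightarrow> twisted_cocycle f \<alpha> A n p = twisted_cocycle f \<alpha> B n p"
    and rec: "\<And>N0 \<eta>. \<eta> > 0 \<Longrightarrow> \<exists>N\<ge>int N0. dist x0 (it N x0) < \<eta>"
    and dense: "closure (range (\<lambda>n. it (int n) x0)) = UNIV"
  shows "\<nu> > 0 \<and> (\<exists>K>0. \<forall>i j :: nat. opnorm (ratio A B (- int i) (it (int i) x0) - ratio A B (- int j) (it (int j) x0))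
      \<le> K * dist (it (int i) x0) (it (int j) x0) powr \<nu>)"
proof (rule dense_orbit_ratio_near_by[OF A B periodic rec])
  fix K \<delta> :: real
  assume K: "K > 0" "\<delta> > 0" "\<nu> > 0"
    and near: "\<And>i j :: nat. \<And>\<eta>. \<lbrakk>dist (it (int i) x0) (it (int j) x0) < \<delta>; \<eta> > 0\<rbrakk> \<Longrightarrow>
      near_by (K * dist (it (int i) x0) (it (int j) x0) powr \<nu> + \<eta>)
        (ratio A B (- int i) (it (int i) x0)) (ratio A B (- int j) (it (int j) x0))"
  define s where "s = (\<lambda>n. it (int n) x0)"
  define p where "p = (\<lambda>n. ratio A B (- int n) (s n))"
  define K1 where "K1 = 2 * K * exp (2 * K * \<delta> powr \<nu>)"
  have K1: "K1 > 0" using K by (simp add: K1_def)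
  have local: "opnorm (p i - p j) \<le> K1 * dist (s i) (s j) powr \<nu> * opnorm (p j)"
    if d: "dist (s i) (s j) < \<delta>" for i j
  proof -
    define t where "t = K * dist (s i) (s j) powr \<nu>"
    have t: "0 \<le> t" "t \<le> K * \<delta> powr \<nu>"
      using K d by (auto simp: t_def intro!: mult_left_mono powr_mono2)
    have "(\<lambda>k. (exp (2 * (t + 1 / real (Suc k))) - 1) * opnorm (p j)) \<longlonglongrightarrow> (exp (2 * (t + 0)) - 1) * opnorm (p j)"
      using LIMSEQ_Suc[OF lim_1_over_n] by (intro tendsto_intros) auto
    moreover have "opnorm (p i - p j) \<le> (exp (2 * (t + 1 / real (Suc k))) - 1) * opnorm (p j)" for k
      using near_by_opnorm_diff[OF near[of i j "1 / real (Suc k)"]] d by (simp add: p_def s_def t_def)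
    ultimately have "opnorm (p i - p j) \<le> (exp (2 * t) - 1) * opnorm (p j)"
      by (intro LIMSEQ_le_const) auto
    also have "\<dots> \<le> (2 * t * exp (2 * t)) * opnorm (p j)"
      by (intro mult_right_mono exp_minus_one_le opnorm_nonneg)
    also have "\<dots> \<le> (2 * t * exp (2 * K * \<delta> powr \<nu>)) * opnorm (p j)"
      using t by (intro mult_right_mono mult_left_mono opnorm_nonneg) auto
    finally show ?thesis by (simp add: K1_def t_def mult_ac)
  qed
  have "UNIV \<subseteq> (\<Union>i. ball (s i) \<delta>)"
  proof
    fix x :: 'a
    have "x \<in> closure (range s)" using dense by (simp add: s_def)
    then show "x \<in> (\<Union>i. ball (s i) \<delta>)" using K(2) by (auto simp: closure_approachable)
  qed
  then obtain I where I: "finite I" "UNIV \<subseteq> (\<Union>i\<in>I. ball (s i) \<delta>)"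
    using compactE_image[OF compact_UNIV, of UNIV "\<lambda>i. ball (s i) \<delta>"] by auto
  define M where "M = (\<Sum>i\<in>I. opnorm (p i))"
  have M: "opnorm (p j) \<le> (K1 * \<delta> powr \<nu> + 1) * M" for j
  proof -
    have "s j \<in> (\<Union>i\<in>I. ball (s i) \<delta>)" using I(2) by blast
    then obtain i where i: "i \<in> I" "dist (s i) (s j) < \<delta>" by auto
    have pi: "opnorm (p i) \<le> M"
      unfolding M_def using I(1) i(1) by (intro member_le_sum) (auto simp: opnorm_nonneg)
    have "opnorm (p j) \<le> opnorm (p j - p i) + opnorm (p i)" by (rule opnorm_triangle_ineq2)
    also have "opnorm (p j - p i) \<le> K1 * dist (s j) (s i) powr \<nu> * opnorm (p i)"
      by (rule local) (use i in \<open>simp add: dist_commute\<close>)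
    also have "\<dots> \<le> K1 * \<delta> powr \<nu> * opnorm (p i)"
      using K1 K i(2) by (intro mult_right_mono mult_left_mono powr_mono2 opnorm_nonneg) (auto simp: dist_commute)
    finally have "opnorm (p j) \<le> (K1 * \<delta> powr \<nu> + 1) * opnorm (p i)" by (simp add: algebra_simps)
    also have "\<dots> \<le> (K1 * \<delta> powr \<nu> + 1) * M" using pi K1 by (intro mult_left_mono) auto
    finally show ?thesis .
  qed
  define M' where "M' = (K1 * \<delta> powr \<nu> + 1) * M + 1"
  have M': "opnorm (p j) \<le> M'" "M' > 0" for j
    using M[of j] opnorm_nonneg[of "p j"] by (simp_all add: M'_def)
  \<comment> \<open>The first summand treats pairs closer than \<delta>; the second treats the
    others, spreading the trivial bound \<open>2 * M'\<close> over
    \<open>\<delta> powr \<nu>\<close>.\<close>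
  define K2 where "K2 = K1 * M' + 2 * M' / \<delta> powr \<nu>"
  have K2: "K2 > 0" using K1 M'(2) K by (simp add: K2_def add_pos_pos)
  have "opnorm (p i - p j) \<le> K2 * dist (s i) (s j) powr \<nu>" for i j
  proof (cases "dist (s i) (s j) < \<delta>")
    case True
    have "opnorm (p i - p j) \<le> K1 * dist (s i) (s j) powr \<nu> * opnorm (p j)" by (rule local[OF True])
    also have "\<dots> \<le> K1 * dist (s i) (s j) powr \<nu> * M'" using K1 M' by (intro mult_left_mono) auto
    also have "\<dots> \<le> K2 * dist (s i) (s j) powr \<nu>"
      using M'(2) K by (simp add: K2_def algebra_simps)
    finally show ?thesis .
  next
    case False
    have "opnorm (p i - p j) \<le> opnorm (p i) + opnorm (p j)"
      using opnorm_add[of "p i" "- p j"] by (simp add: opnorm_uminus)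
    also have "\<dots> \<le> 2 * M' / \<delta> powr \<nu> * \<delta> powr \<nu>"
      using M'(1)[of i] M'(1)[of j] K by simp
    also have "\<dots> \<le> 2 * M' / \<delta> powr \<nu> * dist (s i) (s j) powr \<nu>"
      using False K M'(2) by (intro mult_left_mono powr_mono2) auto
    also have "\<dots> \<le> K2 * dist (s i) (s j) powr \<nu>"
      using K1 M'(2) by (simp add: K2_def algebra_simps)
    finally show ?thesis .
  qed
  then show ?thesis using K2 K(3) unfolding p_def s_def by blast
qed

lemma cohomologous:
  assumes A: "holder_GL \<nu> A" "fiber_bunched f l \<nu> \<alpha> A"
    and B: "holder_GL \<nu> B" "fiber_bunched f l \<nu> \<alpha> B"
    and periodic: "\<And>n p. it n p = p \<Longrightarrow> twisted_cocycle f \<alpha> A n p = twisted_cocycle f \<alpha> B n p"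
    and trans: "transitive_map f"
  shows "\<exists>P. holder_GL \<nu> P \<and> (\<forall>x n. twisted_cocycle f \<alpha> A n x =
     P (it n x) ** twisted_cocycle f \<alpha> B n x ** matrix_inv (aut_pow \<alpha> n (P x)))"
proof (rule dense_orbit_recurrent[OF trans])
  fix x0
  assume dense: "closure (range (\<lambda>n. it (int n) x0)) = UNIV"
    and rec: "\<And>N0 \<eta>. \<eta> > 0 \<Longrightarrow> \<exists>N\<ge>int N0. dist x0 (it N x0) < \<eta>"
  let ?TA = "twisted_cocycle f \<alpha> A" and ?TB = "twisted_cocycle f \<alpha> B"
  have inv: "\<And>x. invertible (A x)" "\<And>x. invertible (B x)"
    using A(1) B(1) by (simp_all add: holder_GL_def carrier_GL)
  note tinv = twisted_cocycle_invertible[of A, OF inv(1)] twisted_cocycle_invertible[of B, OF inv(2)]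
  define s where "s = (\<lambda>n. it (int n) x0)"
  have dense_s: "closure (range s) = UNIV" using dense by (simp add: s_def)
  obtain K where nu: "\<nu> > 0" and K: "K > 0"
    "\<And>i j. opnorm (ratio A B (- int i) (s i) - ratio A B (- int j) (s j)) \<le> K * dist (s i) (s j) powr \<nu>"
    using dense_orbit_ratio_holder[OF A B periodic rec dense] unfolding s_def by blast
  obtain K' where K': "K' > 0"
    "\<And>i j. opnorm (ratio B A (- int i) (s i) - ratio B A (- int j) (s j)) \<le> K' * dist (s i) (s j) powr \<nu>"
    using dense_orbit_ratio_holder[OF B A periodic[symmetric] rec dense] unfolding s_def by blast
  obtain P where P: "\<And>i. P (s i) = ratio A B (- int i) (s i)" "\<And>x y. opnorm (P x - P y) \<le> K * dist x y powr \<nu>"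
    using dense_sequence_extension[OF dense_s nu K] by blast
  obtain R where R: "\<And>i. R (s i) = ratio B A (- int i) (s i)" "\<And>x y. opnorm (R x - R y) \<le> K' * dist x y powr \<nu>"
    using dense_sequence_extension[OF dense_s nu K'] by blast
  have Ps: "P (s i) = ?TA (int i) x0 ** matrix_inv (?TB (int i) x0)" for i
    using ratio_uminus_iterate[of A B "int i" x0, OF inv] by (simp only: P) (simp only: s_def)
  have Rs: "R (s i) = ?TB (int i) x0 ** matrix_inv (?TA (int i) x0)" for i
    using ratio_uminus_iterate[of B A "int i" x0, OF inv(2,1)] by (simp only: R) (simp only: s_def)
  have contP: "continuous_on UNIV P" by (rule continuous_on_opnorm_modulus[OF P(2) nu])
  have contR: "continuous_on UNIV R" by (rule continuous_on_opnorm_modulus[OF R(2) nu])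
  \<comment> \<open>On the dense orbit \<open>P\<close> and \<open>R\<close> are mutually inverse
    quotients of cocycles. The relation passes to the limit and so keeps \<open>P\<close>
    invertible, although invertible matrices are not a closed set.\<close>
  have "P x ** R x = mat 1" for x
    by (rule continuous_eq_on_dense[OF continuous_on_matrix_mult[OF contP contR] continuous_on_const dense_s])
      (auto simp: Ps Rs gl_simps tinv)
  then have invP: "invertible (P x)" for x by (auto simp: invertible_right_inverse)
  have contA: "continuous_on UNIV A" and contB: "continuous_on UNIV B"
    using A(1) B(1) continuous_on_opnorm_modulus[OF _ nu] unfolding holder_GL_def by blast+
  \<comment> \<open>\<alpha> is given as an abstract group automorphism; part (ii) of fiber-bunching
    with exponent 1 makes it Lipschitz on invertible matrices.\<close>
  have cont\<alpha>P: "continuous_on UNIV (\<lambda>x. \<alpha> (P x))"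
  proof -
    obtain D \<rho> where D: "\<forall>T1\<in>carrier GL. \<forall>T2\<in>carrier GL.
        opnorm (aut_pow \<alpha> 1 T1 - aut_pow \<alpha> 1 T2) \<le> D * exp (\<rho> * of_int \<bar>1\<bar>) * opnorm (T1 - T2)" "D > 0"
      using A(2) unfolding fiber_bunched_def by meson
    have "opnorm (\<alpha> (P x) - \<alpha> (P y)) \<le> (D * exp \<rho> * K) * dist x y powr \<nu>" for x y
    proof -
      have "opnorm (\<alpha> (P x) - \<alpha> (P y)) \<le> D * exp \<rho> * opnorm (P x - P y)"
        using D(1) invP by (simp add: carrier_GL aut_pow_1)
      also have "\<dots> \<le> D * exp \<rho> * (K * dist x y powr \<nu>)"
        using D(2) P(2) by (intro mult_left_mono) auto
      finally show ?thesis by (simp add: mult_ac)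
    qed
    then show ?thesis using nu by (rule continuous_on_opnorm_modulus)
  qed
  have contf: "continuous_on UNIV f" using homeo by (simp add: homeomorphism_def)
  have equivariant: "P (f x) ** B x = A x ** \<alpha> (P x)" for x
  proof (rule continuous_eq_on_dense[OF _ _ dense_s])
    show "continuous_on UNIV (\<lambda>x. P (f x) ** B x)"
      by (intro continuous_on_matrix_mult contB continuous_on_compose2[OF contP contf]) simp
    show "continuous_on UNIV (\<lambda>x. A x ** \<alpha> (P x))"
      by (intro continuous_on_matrix_mult contA cont\<alpha>P)
    fix y assume "y \<in> range s"
    then obtain i where y: "y = s i" by auto
    have fy: "f y = s (Suc i)" by (simp add: y s_def int_iterate_of_nat del: of_nat_Suc)
    have Suc: "?TA (int (Suc i)) x0 = A y ** aut_pow \<alpha> 1 (?TA (int i) x0)"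
      "?TB (int (Suc i)) x0 = B y ** aut_pow \<alpha> 1 (?TB (int i) x0)"
      using twisted_cocycle_Suc[of A "int i" x0, OF inv(1)] twisted_cocycle_Suc[of B "int i" x0, OF inv(2)]
      by (simp_all add: y s_def aut_pow_1 add.commute)
    have Py: "P y = ?TA (int i) x0 ** matrix_inv (?TB (int i) x0)" unfolding y by (rule Ps)
    show "P (f y) ** B y = A y ** \<alpha> (P y)"
      unfolding fy aut_pow_1_apply[of "P y"] unfolding Py Ps Suc
      by (simp add: gl_simps aut_simps tinv inv)
  qed
  \<comment> \<open>The one-step relation now holds at every point, so uniqueness of the solution of
    the recursion yields negative times too, although only a forward orbit was dense.\<close>
  have "P (it n x) ** ?TB n x ** matrix_inv (aut_pow \<alpha> n (P x)) = ?TA n x" for n x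
  proof (rule twisted_cocycle_eqI[of A, OF inv(1)])
    show "P (it 0 x) ** ?TB 0 x ** matrix_inv (aut_pow \<alpha> 0 (P x)) = mat 1"
      by (simp add: int_iterate_0 twisted_cocycle_0[of B, OF inv(2)] gl_simps aut_simps invP)
    fix n
    show "invertible (P (it n x) ** ?TB n x ** matrix_inv (aut_pow \<alpha> n (P x)))"
      by (simp add: gl_simps aut_simps invP tinv)
    let ?y = "it n x"
    have fy: "it (n + 1) x = f ?y" using it_it[of 1 n x] by (simp add: int_iterate_1 add.commute)
    let ?Z = "matrix_inv (aut_pow \<alpha> (n + 1) (P x))"
    have Z: "\<alpha> (matrix_inv (aut_pow \<alpha> n (P x))) = ?Z"
      unfolding aut_pow_1_apply[of "matrix_inv (aut_pow \<alpha> n (P x))"]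
      by (simp add: aut_simps invP add.commute)
    have "A ?y ** \<alpha> (P ?y ** ?TB n x ** matrix_inv (aut_pow \<alpha> n (P x)))
        = A ?y ** (\<alpha> (P ?y) ** \<alpha> (?TB n x) ** ?Z)"
      by (simp add: Z \<alpha>_mult invP tinv gl_simps aut_pow_invertible)
    also have "\<dots> = A ?y ** \<alpha> (P ?y) ** \<alpha> (?TB n x) ** ?Z"
      by (simp only: matrix_mul_assoc)
    also have "\<dots> = P (f ?y) ** B ?y ** \<alpha> (?TB n x) ** ?Z"
      by (simp only: equivariant)
    also have "\<dots> = P (it (n + 1) x) ** ?TB (n + 1) x ** ?Z"
      by (simp only: fy twisted_cocycle_Suc[of B, OF inv(2)] matrix_mul_assoc)
    finally show "P (it (n + 1) x) ** ?TB (n + 1) x ** ?Z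
      = A ?y ** \<alpha> (P ?y ** ?TB n x ** matrix_inv (aut_pow \<alpha> n (P x)))" ..
  qed
  moreover have "holder_GL \<nu> P"
    unfolding holder_GL_def carrier_GL using invP P(2) K(1) by blast
  ultimately show ?thesis by metis
qed

end

theorem theorem1p1:
  fixes f :: "'a::metric_space \<Rightarrow> 'a"
    and A B :: "'a \<Rightarrow> real ^ 'd ^ 'd"
    and \<alpha> :: "real ^ 'd ^ 'd \<Rightarrow> real ^ 'd ^ 'd"
    and C \<epsilon> l \<tau> \<nu> :: real
  assumes "compact (UNIV :: 'a set)"
    and "homeomorphism UNIV UNIV f (inv_into UNIV f)"
    and "\<exists>L. L-lipschitz_on UNIV f"
    and "transitive_map f"
    and "hyperbolic f C \<epsilon> l \<tau>"
    and "holder_GL \<nu> A" and "holder_GL \<nu> B"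
    and "\<alpha> \<in> carrier (AutoGroup GL)"
    and "fiber_bunched f l \<nu> \<alpha> A" and "fiber_bunched f l \<nu> \<alpha> B"
    and "\<And>n p. int_iterate f n p = p \<Longrightarrow> twisted_cocycle f \<alpha> A n p = twisted_cocycle f \<alpha> B n p"
  shows "\<exists>P. holder_GL \<nu> P \<and>
    (\<forall>x n. twisted_cocycle f \<alpha> A n x =
       P (int_iterate f n x) ** twisted_cocycle f \<alpha> B n x ** matrix_inv (aut_pow \<alpha> n (P x)))"
proof -
  interpret twisted_hyperbolic f C \<epsilon> l \<tau> \<alpha>
    by unfold_locales (use assms in auto)
  show ?thesis by (rule cohomologous) (use assms in auto)
qed

end
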